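(* Consider an ideal tetrahedron in hyperbolic 3-space $\mathbb{H}^3$ with ideal vertices numbered $0,1,2,3$, and a spin decoration on it, i.e. a spin-decorated horosphere $(H_i,W_i)$ centred at each ideal vertex $i$. Let $\lambda_{ij}$ be the complex lambda length from $(H_i,W_i)$ to $(H_j,W_j)$. Then $$\lambda_{01}\lambda_{23}+\lambda_{03}\lambda_{12}=\lambda_{02}\lambda_{13}.$$
   Context: An ideal tetrahedron has all its (four distinct) vertices on $\partial\mathbb{H}^3$. $\mathbb{H}^3$ is oriented. Spin decorations. A decoration on a horosphere $H$ is a tangent oriented line field invariant under all parabolic isometries fixing $H$ (equivalently a parallel unit tangent vector field $v$ on $H$). The centre of $H$ is its point at infinity. A frame is a right-handed orthonormal frame at a point of $\mathbb{H}^3$; $\mathrm{Fr}\to\mathbb{H}^3$ is the bundle of frames and $\mathrm{Fr}^S$ its double (universal) cover, whose points are spin frames. Rotations and translations of spin frames are obtained by lifting to $\mathrm{Fr}^S$ the corresponding paths of rotated/translated frames; rotation by $2\pi$ interchanges the two lifts of a frame. Let $N^{out}$ (resp. $N^{in}$) be the unit normal field along $H$ pointing towards (resp. away from) its centre. For a decoration $v$ on $H$, the inward and outward frame fields are $(N^{in},v,N^{in}\times v)$ and $(N^{out},v,N^{out}\times v)$. An inward (outward) spin decoration is a continuous lift of the inward (outward) frame field along $H$ to $\mathrm{Fr}^S$. A spin decoration on $H$ is a pair $W=(W^{in},W^{out})$ of an inward and an outward spin decoration lifting the frame fields of the same $v$ such that $W^{out}$ is obtained from $W^{in}$ by rotation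 of angle $-\pi$ about $v$ at each point (equivalently $W^{in}$ from $W^{out}$ by rotation of angle $\pi$ about $v$). Complex lambda length. A spin frame at a point of an oriented geodesic $\gamma$ is adapted to $\gamma$ if it lifts a frame whose first vector is positively tangent to $\gamma$. The complex distance from one spin frame adapted to $\gamma$ to another is $\rho+i\theta$, where translation along $\gamma$ by signed distance $\rho$ followed by rotation about $\gamma$ by angle $\theta$ (signed by the orientation of $\gamma$ and the right-hand rule) takes the first to the second; it is well defined modulo $4\pi i$. For spin-decorated horospheres $(H_1,W_1),(H_2,W_2)$ with distinct centres $z_1,z_2$, let $\gamma_{12}$ be the oriented geodesic from $z_1$ to $z_2$ and $p_i=\gamma_{12}\cap H_i$; the complex lambda length from $(H_1,W_1)$ to $(H_2,W_2)$ is $\exp(d/2)$, where $d$ is the complex distance from $W_1^{in}(p_1)$ to $W_2^{out}(p_2)$ along $\gamma_{12}$. This is a well-defined complex number. *)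

theory Defs
  imports "HOL-Analysis.Analysis"
begin

section \<open>Hyperbolic 3-space: the hyperboloid model\<close>

text \<open>
  Points of \<open>\<real>\<^sup>1\<^sup>,\<^sup>3\<close> are vectors of type \<open>real ^ 4\<close>; component 1 is the time coordinate.
  The tangent space of the hyperboloid at \<open>x\<close> is the Minkowski-orthogonal complement of \<open>x\<close>, on
  which \<open>mink\<close> is the Riemannian metric.
\<close>

definition mink :: "real ^ 4 \<Rightarrow> real ^ 4 \<Rightarrow> real" where
  "mink x y = - (x $ 1) * (y $ 1) + x $ 2 * y $ 2 + x $ 3 * y $ 3 + x $ 4 * y $ 4"

definition hyp3 :: "(real ^ 4) set" where
  "hyp3 = {x. mink x x = - 1 \<and> x $ 1 > 0}"

definition unit_tangent :: "real ^ 4 \<Rightarrow> real ^ 4 \<Rightarrow> bool" where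
  "unit_tangent x u \<longleftrightarrow> mink x u = 0 \<and> mink u u = 1"

text \<open>The orientation: \<open>volume_form x\<close> is the Riemannian volume form at \<open>x\<close>, and \<open>hcross x u v\<close> is
  the cross product \<open>u \<times> v\<close> in the tangent space at \<open>x\<close>, that is, the vector dual to
  \<open>volume_form x u v\<close>.\<close>

definition volume_form :: "real ^ 4 \<Rightarrow> real ^ 4 \<Rightarrow> real ^ 4 \<Rightarrow> real ^ 4 \<Rightarrow> real" where
  "volume_form x u v w = det (vector [x, u, v, w] :: real ^ 4 ^ 4)"

definition hcross :: "real ^ 4 \<Rightarrow> real ^ 4 \<Rightarrow> real ^ 4 \<Rightarrow> real ^ 4" where
  "hcross x u v = (THE w. \<forall>y. mink w y = volume_form x u v y)"

text \<open>Orientation-preserving isometries of the hyperboloid are the restrictions of the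
  time-orientation preserving Lorentz transformations of determinant 1.\<close>

definition orient_isometry :: "real ^ 4 ^ 4 \<Rightarrow> bool" where
  "orient_isometry A \<longleftrightarrow>
     (\<forall>x y. mink (A *v x) (A *v y) = mink x y) \<and> (\<forall>x\<in>hyp3. A *v x \<in> hyp3) \<and> det A = 1"

text \<open>A point at infinity is a future-pointing light ray (without its apex).\<close>

definition ideal_boundary :: "(real ^ 4) set set" where
  "ideal_boundary = {{c *\<^sub>R n |c. c > 0} |n. mink n n = 0 \<and> n $ 1 > 0}"

definition parabolic :: "real ^ 4 ^ 4 \<Rightarrow> bool" where
  "parabolic A \<longleftrightarrow> orient_isometry A \<and> (\<forall>x\<in>hyp3. A *v x \<noteq> x) \<and>
     (\<exists>!z. z \<in> ideal_boundary \<and> (*v) A ` z = z)"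

text \<open>The unit-speed geodesic through \<open>x\<close> with initial velocity \<open>u\<close>. Convergence to a point at
  infinity is convergence in the projective ball model, the section \<open>x $ 1 = 1\<close>.\<close>

definition geodesic :: "real ^ 4 \<Rightarrow> real ^ 4 \<Rightarrow> real \<Rightarrow> real ^ 4" where
  "geodesic x u s = cosh s *\<^sub>R x + sinh s *\<^sub>R u"

definition tends_to_ideal :: "(real \<Rightarrow> real ^ 4) \<Rightarrow> (real ^ 4) set \<Rightarrow> real filter \<Rightarrow> bool" where
  "tends_to_ideal \<gamma> z F \<longleftrightarrow> (\<exists>n\<in>z. ((\<lambda>s. (1 / (\<gamma> s $ 1)) *\<^sub>R \<gamma> s) \<longlongrightarrow> n) F)"

definition geodesic_from_to :: "(real ^ 4) set \<Rightarrow> (real ^ 4) set \<Rightarrow> (real \<Rightarrow> real ^ 4) \<Rightarrow> bool" where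
  "geodesic_from_to z\<^sub>1 z\<^sub>2 \<gamma> \<longleftrightarrow>
     (\<exists>x\<in>hyp3. \<exists>u. unit_tangent x u \<and> \<gamma> = geodesic x u) \<and>
     tends_to_ideal \<gamma> z\<^sub>1 at_bot \<and> tends_to_ideal \<gamma> z\<^sub>2 at_top"


section \<open>Horospheres and decorations\<close>

definition horosphere :: "(real ^ 4) set \<Rightarrow> (real ^ 4) set \<Rightarrow> bool" where
  "horosphere z H \<longleftrightarrow> z \<in> ideal_boundary \<and> (\<exists>n\<in>z. H = {x \<in> hyp3. mink x n = - 1})"

text \<open>Tangent vectors at \<open>x\<close> to the horosphere centred at \<open>z\<close> through \<open>x\<close>.\<close>

definition horo_tangent :: "(real ^ 4) set \<Rightarrow> real ^ 4 \<Rightarrow> (real ^ 4) set" where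
  "horo_tangent z x = {u. mink x u = 0 \<and> (\<forall>n\<in>z. mink n u = 0)}"

definition normal_out :: "(real ^ 4) set \<Rightarrow> real ^ 4 \<Rightarrow> real ^ 4" where
  "normal_out z x = (THE N. unit_tangent x N \<and> (\<forall>u\<in>horo_tangent z x. mink N u = 0) \<and>
     tends_to_ideal (geodesic x N) z at_top)"

definition normal_in :: "(real ^ 4) set \<Rightarrow> real ^ 4 \<Rightarrow> real ^ 4" where
  "normal_in z x = - normal_out z x"

text \<open>The oriented line field is given by its unit vector field \<open>v\<close>.\<close>

definition decoration :: "(real ^ 4) set \<Rightarrow> (real ^ 4) set \<Rightarrow> (real ^ 4 \<Rightarrow> real ^ 4) \<Rightarrow> bool" where
  "decoration z H v \<longleftrightarrow>
     (\<forall>x\<in>H. v x \<in> horo_tangent z x \<and> mink (v x) (v x) = 1) \<and>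
     (\<forall>A. parabolic A \<and> (*v) A ` H = H \<longrightarrow> (\<forall>x\<in>H. A *v v x = v (A *v x)))"


section \<open>Frames and spin frames\<close>

text \<open>A frame is stored as its base point followed by its three vectors.\<close>

type_synonym frame = "(real ^ 4) \<times> (real ^ 4) \<times> (real ^ 4) \<times> (real ^ 4)"

definition frames :: "frame set" where
  "frames = {(x, a, b, c). x \<in> hyp3 \<and> unit_tangent x a \<and> unit_tangent x b \<and> unit_tangent x c \<and>
     mink a b = 0 \<and> mink b c = 0 \<and> mink c a = 0 \<and> volume_form x a b c > 0}"

text \<open>The spin frame bundle is any simply connected double cover of the frame bundle; \<open>pr\<close> sends
  a spin frame to the frame that it lifts.\<close>

definition spin_frame_bundle :: "'s::topological_space set \<Rightarrow> ('s \<Rightarrow> frame) \<Rightarrow> bool" where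
  "spin_frame_bundle FrS pr \<longleftrightarrow> covering_space FrS pr frames \<and> simply_connected FrS \<and>
     (\<forall>f\<in>frames. card {s \<in> FrS. pr s = f} = 2)"

text \<open>Rodrigues' formula: rotation of a vector \<open>e\<close> at \<open>x\<close> by the angle \<open>t\<close> about the unit vector
  \<open>a\<close>, with the right-hand rule.\<close>

definition rotate_vec :: "real ^ 4 \<Rightarrow> real ^ 4 \<Rightarrow> real \<Rightarrow> real ^ 4 \<Rightarrow> real ^ 4" where
  "rotate_vec x a t e =
     cos t *\<^sub>R e + ((1 - cos t) * mink a e) *\<^sub>R a + sin t *\<^sub>R hcross x a e"

fun rotate_frame :: "(frame \<Rightarrow> real ^ 4) \<Rightarrow> real \<Rightarrow> frame \<Rightarrow> frame" where
  "rotate_frame axs t (x, a, b, c) =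
     (let k = axs (x, a, b, c) in (x, rotate_vec x k t a, rotate_vec x k t b, rotate_vec x k t c))"

text \<open>Translation along the geodesic through \<open>x\<close> in the direction \<open>a\<close> of the first vector. Vectors
  tangent to the hyperboloid at \<open>x\<close> and orthogonal to \<open>a\<close> are constant under parallel transport
  along this geodesic.\<close>

fun translate_frame :: "real \<Rightarrow> frame \<Rightarrow> frame" where
  "translate_frame t (x, a, b, c) = (geodesic x a t, sinh t *\<^sub>R x + cosh t *\<^sub>R a, b, c)"

text \<open>If \<open>m t f\<close> is the frame \<open>f\<close> moved by the amount \<open>t\<close>, then \<open>spin_move FrS pr m t s s'\<close> says
  that the path of frames from \<open>m 0 (pr s)\<close> to \<open>m t (pr s)\<close> has a lift from \<open>s\<close> to \<open>s'\<close>.\<close>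

definition spin_move ::
  "'s::topological_space set \<Rightarrow> ('s \<Rightarrow> frame) \<Rightarrow> (real \<Rightarrow> frame \<Rightarrow> frame) \<Rightarrow> real \<Rightarrow> 's \<Rightarrow> 's \<Rightarrow> bool"
  where
  "spin_move FrS pr m t s s' \<longleftrightarrow>
     (\<exists>g. path g \<and> path_image g \<subseteq> FrS \<and> pathstart g = s \<and> pathfinish g = s' \<and>
          (\<forall>r\<in>{0..1}. pr (g r) = m (r * t) (pr s)))"

abbreviation first_vec :: "frame \<Rightarrow> real ^ 4" where
  "first_vec f \<equiv> fst (snd f)"

abbreviation second_vec :: "frame \<Rightarrow> real ^ 4" where
  "second_vec f \<equiv> fst (snd (snd f))"


section \<open>Spin decorations\<close>

definition inward_frame :: "(real ^ 4) set \<Rightarrow> (real ^ 4 \<Rightarrow> real ^ 4) \<Rightarrow> real ^ 4 \<Rightarrow> frame" where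
  "inward_frame z v x = (x, normal_in z x, v x, hcross x (normal_in z x) (v x))"

definition outward_frame :: "(real ^ 4) set \<Rightarrow> (real ^ 4 \<Rightarrow> real ^ 4) \<Rightarrow> real ^ 4 \<Rightarrow> frame" where
  "outward_frame z v x = (x, normal_out z x, v x, hcross x (normal_out z x) (v x))"

definition continuous_lift ::
  "'s::topological_space set \<Rightarrow> ('s \<Rightarrow> frame) \<Rightarrow> (real ^ 4) set \<Rightarrow> (real ^ 4 \<Rightarrow> frame) \<Rightarrow>
    (real ^ 4 \<Rightarrow> 's) \<Rightarrow> bool" where
  "continuous_lift FrS pr H F W \<longleftrightarrow>
     continuous_on H W \<and> (\<forall>x\<in>H. W x \<in> FrS \<and> pr (W x) = F x)"

text \<open>In inward and outward frames the second vector is \<open>v\<close>, so the last condition is rotation by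
  \<open>- \<pi>\<close> about \<open>v\<close>.\<close>

definition spin_decoration ::
  "'s::topological_space set \<Rightarrow> ('s \<Rightarrow> frame) \<Rightarrow> (real ^ 4) set \<Rightarrow> (real ^ 4) set \<Rightarrow>
    (real ^ 4 \<Rightarrow> 's) \<Rightarrow> (real ^ 4 \<Rightarrow> 's) \<Rightarrow> bool" where
  "spin_decoration FrS pr z H Win Wout \<longleftrightarrow>
     (\<exists>v. decoration z H v \<and>
          continuous_lift FrS pr H (inward_frame z v) Win \<and>
          continuous_lift FrS pr H (outward_frame z v) Wout \<and>
          (\<forall>x\<in>H. spin_move FrS pr (rotate_frame second_vec) (- pi) (Win x) (Wout x)))"


section \<open>Complex lambda length\<close>

definition adapted ::
  "'s::topological_space set \<Rightarrow> ('s \<Rightarrow> frame) \<Rightarrow> (real \<Rightarrow> real ^ 4) \<Rightarrow> 's \<Rightarrow> bool" where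
  "adapted FrS pr \<gamma> s \<longleftrightarrow> s \<in> FrS \<and>
     (\<exists>t. fst (pr s) = \<gamma> t \<and> first_vec (pr s) = vector_derivative \<gamma> (at t))"

text \<open>For adapted spin frames, translation along the first vector and rotation about it are
  translation along and rotation about \<open>\<gamma>\<close>. The value \<open>d\<close> is unique only modulo \<open>4 \<pi> \<i>\<close>.\<close>

definition complex_distance ::
  "'s::topological_space set \<Rightarrow> ('s \<Rightarrow> frame) \<Rightarrow> (real \<Rightarrow> real ^ 4) \<Rightarrow> 's \<Rightarrow> 's \<Rightarrow> complex \<Rightarrow> bool"
  where
  "complex_distance FrS pr \<gamma> s s' d \<longleftrightarrow> adapted FrS pr \<gamma> s \<and> adapted FrS pr \<gamma> s' \<and>
     (\<exists>m. spin_move FrS pr translate_frame (Re d) s m \<and>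
          spin_move FrS pr (rotate_frame first_vec) (Im d) m s')"

definition complex_lambda_length ::
  "'s::topological_space set \<Rightarrow> ('s \<Rightarrow> frame) \<Rightarrow>
    (real ^ 4) set \<Rightarrow> (real ^ 4) set \<Rightarrow> (real ^ 4 \<Rightarrow> 's) \<Rightarrow>
    (real ^ 4) set \<Rightarrow> (real ^ 4) set \<Rightarrow> (real ^ 4 \<Rightarrow> 's) \<Rightarrow> complex" where
  "complex_lambda_length FrS pr z\<^sub>1 H\<^sub>1 Win\<^sub>1 z\<^sub>2 H\<^sub>2 Wout\<^sub>2 =
     (THE l. \<exists>\<gamma> p\<^sub>1 p\<^sub>2 d. geodesic_from_to z\<^sub>1 z\<^sub>2 \<gamma> \<and> p\<^sub>1 \<in> range \<gamma> \<inter> H\<^sub>1 \<and> p\<^sub>2 \<in> range \<gamma> \<inter> H\<^sub>2 \<and>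
        complex_distance FrS pr \<gamma> (Win\<^sub>1 p\<^sub>1) (Wout\<^sub>2 p\<^sub>2) d \<and> l = exp (d / 2))"

end

theory Submission
  imports Defs
begin

text \<open>
  A spin-decorated horosphere is a spinor, a vector \<open>\<kappa>\<close> in \<open>\<complex>\<^sup>2\<close>, and a complex lambda length is, up
  to a constant, the determinant of two spinors. Ptolemy's equation is then the Pluecker relation
  (\<open>spinor_plucker\<close>) between the six minors of the \<open>2 \<times> 4\<close> matrix of the spinors of the four vertices.

  A frame \<open>(x, a, b, c)\<close> determines the null flag with flagpole \<open>x + a\<close> and flag direction \<open>b\<close>. The
  self-dual part of the bivector \<open>(x + a) \<and> b\<close> is a symmetric complex \<open>2 \<times> 2\<close> matrix of rank one,
  hence of the form \<open>\<kappa> \<kappa>\<^sup>T\<close> with \<open>\<kappa>\<close> determined up to sign. The map \<open>\<kappa> \<mapsto> \<kappa> \<kappa>\<^sup>T\<close> is a double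
  covering of the cone of these matrices, and as the bundle of spin frames is simply connected, a choice
  of sign can be made there that is continuous along paths (\<open>spin_frame_spinor_exists\<close>).

  Under translation by \<open>\<rho>\<close> along \<open>a\<close> the flag is multiplied by \<open>exp \<rho>\<close>, under rotation by \<open>\<theta>\<close> about
  \<open>a\<close> by \<open>exp (\<i> \<theta>)\<close>. Therefore spin frames at complex distance \<open>d\<close> have spinors that differ by the
  factor \<open>exp (d / 2)\<close> (\<open>spinor_complex_distance\<close>): the factor \<open>1/2\<close> in the definition of the lambda
  length is the square root that is taken in passing from flags to spinors. Rotation by \<open>-\<pi>\<close> about
  \<open>b\<close>, which relates inward to outward spin frames, leads to a spinor whose determinant with the first
  one is always \<open>- 2 \<i>\<close> (\<open>spinor_det_rotate_second\<close>).

  Along a horosphere the outward flag is constant: the flagpole is the null vector that defines the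
  horosphere, and a parabolic isometry that fixes it changes tangent vectors of the horosphere only by
  multiples of the flagpole (\<open>decoration_flag_constant\<close>). So its outward spin decoration has a single
  spinor, and evaluating along the geodesic from one centre to the other gives
  \<open>\<lambda>\<^sub>i\<^sub>j = (\<i> / 2) det (\<kappa>\<^sub>i, \<kappa>\<^sub>j)\<close> (\<open>complex_lambda_length_eq_spinor_det\<close>).
\<close>


section \<open>Linear algebra of Minkowski space\<close>

lemma vector_4_nth [simp]:
  "(vector [p, q, r, s] :: 'a::zero ^ 4) $ 1 = p"
  "(vector [p, q, r, s] :: 'a::zero ^ 4) $ 2 = q"
  "(vector [p, q, r, s] :: 'a::zero ^ 4) $ 3 = r"
  "(vector [p, q, r, s] :: 'a::zero ^ 4) $ 4 = s"
  unfolding vector_def by simp_all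

lemma vec4_eq_iff: "x = y \<longleftrightarrow> x $ 1 = y $ 1 \<and> x $ 2 = y $ 2 \<and> x $ 3 = y $ 3 \<and> x $ 4 = y $ 4"
  for x y :: "'a ^ 4"
  by (simp add: vec_eq_iff forall_4)

lemma det_4:
  "det (A :: 'a::comm_ring_1 ^ 4 ^ 4) =
     A$1$1 * (A$2$2 * (A$3$3 * A$4$4 - A$3$4 * A$4$3)
            - A$2$3 * (A$3$2 * A$4$4 - A$3$4 * A$4$2)
            + A$2$4 * (A$3$2 * A$4$3 - A$3$3 * A$4$2))
   - A$1$2 * (A$2$1 * (A$3$3 * A$4$4 - A$3$4 * A$4$3)
            - A$2$3 * (A$3$1 * A$4$4 - A$3$4 * A$4$1)
            + A$2$4 * (A$3$1 * A$4$3 - A$3$3 * A$4$1))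
   + A$1$3 * (A$2$1 * (A$3$2 * A$4$4 - A$3$4 * A$4$2)
            - A$2$2 * (A$3$1 * A$4$4 - A$3$4 * A$4$1)
            + A$2$4 * (A$3$1 * A$4$2 - A$3$2 * A$4$1))
   - A$1$4 * (A$2$1 * (A$3$2 * A$4$3 - A$3$3 * A$4$2)
            - A$2$2 * (A$3$1 * A$4$3 - A$3$3 * A$4$1)
            + A$2$3 * (A$3$1 * A$4$2 - A$3$2 * A$4$1))"
proof -
  have f1: "finite {2::4, 3, 4}" "1 \<notin> {2::4, 3, 4}" by auto
  have f2: "finite {3::4, 4}" "2 \<notin> {3::4, 4}" by auto
  have f3: "finite {4::4}" "3 \<notin> {4::4}" by auto
  show ?thesis
    unfolding det_def UNIV_4
    unfolding sum_over_permutations_insert[OF f1]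
    unfolding sum_over_permutations_insert[OF f2]
    unfolding sum_over_permutations_insert[OF f3]
    unfolding permutes_sing
    by (simp add: sign_swap_id permutation_swap_id sign_compose permutation_compose sign_id swap_id_eq algebra_simps)
qed

lemma mink_bilinear [simp]:
  "mink (x + y) w = mink x w + mink y w" "mink w (x + y) = mink w x + mink w y"
  "mink (x - y) w = mink x w - mink y w" "mink w (x - y) = mink w x - mink w y"
  "mink (c *\<^sub>R x) w = c * mink x w" "mink w (c *\<^sub>R x) = c * mink w x"
  "mink (- x) w = - mink x w" "mink w (- x) = - mink w x"
  "mink 0 w = 0" "mink w 0 = 0"
  by (simp_all add: mink_def algebra_simps)

lemma mink_commute: "mink x y = mink y x"
  by (simp add: mink_def algebra_simps)

lemma mink_nondegenerate:
  assumes "\<And>y. mink w y = mink w' y"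
  shows "w = w'"
  using assms[of "axis 1 1"] assms[of "axis 2 1"] assms[of "axis 3 1"] assms[of "axis 4 1"]
  by (simp add: mink_def vec4_eq_iff axis_def)

lemma volume_form_expand:
  "volume_form x u v w =
     x$1 * (u$2 * (v$3 * w$4 - v$4 * w$3) - u$3 * (v$2 * w$4 - v$4 * w$2) + u$4 * (v$2 * w$3 - v$3 * w$2))
   - x$2 * (u$1 * (v$3 * w$4 - v$4 * w$3) - u$3 * (v$1 * w$4 - v$4 * w$1) + u$4 * (v$1 * w$3 - v$3 * w$1))
   + x$3 * (u$1 * (v$2 * w$4 - v$4 * w$2) - u$2 * (v$1 * w$4 - v$4 * w$1) + u$4 * (v$1 * w$2 - v$2 * w$1))
   - x$4 * (u$1 * (v$2 * w$3 - v$3 * w$2) - u$2 * (v$1 * w$3 - v$3 * w$1) + u$3 * (v$1 * w$2 - v$2 * w$1))"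
  unfolding volume_form_def det_4 by simp

text \<open>The listed vector is dual to the volume form because the entries are the cofactors of the last row
  of the determinant, with the sign of the time entry changed; nondegeneracy makes it the only one.\<close>

lemma hcross_expand:
  "hcross x u v = vector
    [x$2 * (u$3 * v$4 - u$4 * v$3) - x$3 * (u$2 * v$4 - u$4 * v$2) + x$4 * (u$2 * v$3 - u$3 * v$2),
     x$1 * (u$3 * v$4 - u$4 * v$3) - x$3 * (u$1 * v$4 - u$4 * v$1) + x$4 * (u$1 * v$3 - u$3 * v$1),
     - x$1 * (u$2 * v$4 - u$4 * v$2) + x$2 * (u$1 * v$4 - u$4 * v$1) - x$4 * (u$1 * v$2 - u$2 * v$1),
     x$1 * (u$2 * v$3 - u$3 * v$2) - x$2 * (u$1 * v$3 - u$3 * v$1) + x$3 * (u$1 * v$2 - u$2 * v$1)]"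
    (is "_ = ?h")
proof -
  have "mink ?h y = volume_form x u v y" for y
    by (simp add: volume_form_expand mink_def algebra_simps)
  then show ?thesis
    unfolding hcross_def
    by (intro the_equality mink_nondegenerate) auto
qed

lemma mink_hcross: "mink (hcross x u v) y = volume_form x u v y"
  by (simp add: hcross_expand volume_form_expand mink_def algebra_simps)

lemma hcross_linear:
  "hcross x a (b + c) = hcross x a b + hcross x a c"
  "hcross x a (t *\<^sub>R b) = t *\<^sub>R hcross x a b"
  "hcross x a a = 0"
  by (simp_all add: hcross_expand vec4_eq_iff algebra_simps)

lemma volume_form_swap:
  "volume_form x a c (- b) = volume_form x a b c"
  "volume_form x b a (- c) = volume_form x a b c"
  by (simp_all add: volume_form_expand algebra_simps)

lemma volume_form_alternating:
  "volume_form x a b x = 0" "volume_form x a b a = 0" "volume_form x a b b = 0"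
  by (simp_all add: volume_form_expand algebra_simps)


lemma mink_spatial_nonneg: "w $ 1 = 0 \<Longrightarrow> mink w w \<ge> 0"
  by (simp add: mink_def)

lemma mink_spatial_eq_0: "w $ 1 = 0 \<Longrightarrow> mink w w \<le> 0 \<Longrightarrow> w = 0"
proof -
  assume "w $ 1 = 0" "mink w w \<le> 0"
  then have "(w $ 2)\<^sup>2 + (w $ 3)\<^sup>2 + (w $ 4)\<^sup>2 \<le> 0"
    by (simp add: mink_def power2_eq_square)
  moreover have "(w $ 2)\<^sup>2 \<ge> 0" "(w $ 3)\<^sup>2 \<ge> 0" "(w $ 4)\<^sup>2 \<ge> 0" by simp_all
  ultimately have "(w $ 2)\<^sup>2 = 0" "(w $ 3)\<^sup>2 = 0" "(w $ 4)\<^sup>2 = 0" by linarith+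
  then show "w = 0" using \<open>w $ 1 = 0\<close> by (simp add: vec4_eq_iff)
qed

text \<open>The combination \<open>x\<^sub>1 y - y\<^sub>1 x\<close> has no time component, so \<open>mink\<close> is nonnegative on it and
  vanishes only if it is zero. This is the reversed Cauchy-Schwarz inequality, with its equality
  case, in the form in which the causal lemmas below use it.\<close>

lemma mink_time_combination:
  "mink (x $ 1 *\<^sub>R y - y $ 1 *\<^sub>R x) (x $ 1 *\<^sub>R y - y $ 1 *\<^sub>R x)
    = (x $ 1)\<^sup>2 * mink y y + (y $ 1)\<^sup>2 * mink x x - 2 * (x $ 1) * (y $ 1) * mink x y"
  by (simp add: mink_commute[of y x] power2_eq_square algebra_simps)

text \<open>A causal vector in the past would have a nonnegative product with \<open>x\<close>. This is how images under
  isometries and points built as linear combinations are recognised as points of the upper sheet.\<close>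

lemma future_if_mink_neg:
  assumes "mink x x \<le> 0" "x $ 1 > 0" "mink y y \<le> 0" "mink x y < 0"
  shows "y $ 1 > 0"
proof (rule ccontr)
  assume "\<not> y $ 1 > 0"
  then consider "y $ 1 = 0" | "y $ 1 < 0" by linarith
  then show False
  proof cases
    case 1
    then show False
      using mink_spatial_eq_0[of y] assms by simp
  next
    case 2
    have "(x $ 1)\<^sup>2 * mink y y \<le> 0" "(y $ 1)\<^sup>2 * mink x x \<le> 0"
      using assms by (auto simp: mult_nonneg_nonpos)
    moreover have "(x $ 1) * (y $ 1) * mink x y > 0"
      using assms 2 by (simp add: mult_neg_neg mult_pos_neg)
    ultimately show False
      using mink_time_combination[of x y] mink_spatial_nonneg[of "x $ 1 *\<^sub>R y - y $ 1 *\<^sub>R x"]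
      by (simp add: algebra_simps)
  qed
qed

lemma mink_neg_if_future:
  assumes "mink x x < 0" "x $ 1 > 0" "mink y y \<le> 0" "y $ 1 > 0"
  shows "mink x y < 0"
proof -
  have nonneg: "mink (x $ 1 *\<^sub>R y - y $ 1 *\<^sub>R x) (x $ 1 *\<^sub>R y - y $ 1 *\<^sub>R x) \<ge> 0"
    by (rule mink_spatial_nonneg) simp
  have "(x $ 1)\<^sup>2 * mink y y \<le> 0" "(y $ 1)\<^sup>2 * mink x x < 0"
    using assms by (auto simp: mult_nonneg_nonpos mult_pos_neg)
  then have "2 * (x $ 1) * (y $ 1) * mink x y < 0"
    using mink_time_combination[of x y] nonneg by linarith
  then show ?thesis
    using assms by (simp add: mult_less_0_iff zero_less_mult_iff)
qed

lemma null_orthogonal_parallel: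
  assumes "mink m m = 0" "mink n n = 0" "n $ 1 > 0" "m $ 1 > 0" "mink n m \<ge> 0"
  shows "m = (m $ 1 / n $ 1) *\<^sub>R n"
proof -
  have "n $ 1 *\<^sub>R m - m $ 1 *\<^sub>R n = 0"
    using assms by (intro mink_spatial_eq_0) (simp_all only: mink_time_combination, simp_all)
  then have "(1 / n $ 1) *\<^sub>R (n $ 1 *\<^sub>R m) = (1 / n $ 1) *\<^sub>R (m $ 1 *\<^sub>R n)" by simp
  then show ?thesis using assms by simp
qed

lemma volume_form_boost:
  "volume_form (p *\<^sub>R x + q *\<^sub>R a) (q *\<^sub>R x + p *\<^sub>R a) b c = (p * p - q * q) * volume_form x a b c"
  by (simp add: volume_form_expand algebra_simps)

lemma volume_form_rotate:
  "volume_form x a (p *\<^sub>R b + q *\<^sub>R c) (p *\<^sub>R c - q *\<^sub>R b) = (p * p + q * q) * volume_form x a b c"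
  by (simp add: volume_form_expand algebra_simps)


section \<open>Frames\<close>

definition gram :: "real ^ 4 ^ 4" where
  "gram = vector [vector [- 1, 0, 0, 0], vector [0, 1, 0, 0], vector [0, 0, 1, 0], vector [0, 0, 0, 1]]"

lemma mink_gram: "mink x y = x \<bullet> (gram *v y)"
  by (simp add: mink_def inner_vec_def sum_4 gram_def matrix_vector_mult_def)

lemma det_gram: "det gram = - 1"
  by (simp add: det_4 gram_def)

lemma frameD:
  assumes "(x, a, b, c) \<in> frames"
  shows "x \<in> hyp3" "mink x x = - 1" "mink a a = 1" "mink b b = 1" "mink c c = 1"
    "mink x a = 0" "mink x b = 0" "mink x c = 0" "mink a b = 0" "mink b c = 0" "mink a c = 0"
    "mink a x = 0" "mink b x = 0" "mink c x = 0" "mink b a = 0" "mink c b = 0" "mink c a = 0"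
    "volume_form x a b c > 0"
  using assms by (auto simp: frames_def unit_tangent_def hyp3_def mink_commute)

text \<open>The Gram matrix of a frame is that of the standard basis; taking determinants shows that the volume
  is \<open>\<plusminus>1\<close>, and the orientation excludes \<open>-1\<close>.\<close>

lemma frame_volume:
  assumes "(x, a, b, c) \<in> frames"
  shows "volume_form x a b c = 1"
proof -
  let ?M = "vector [x, a, b, c] :: real ^ 4 ^ 4"
  have "(?M ** gram ** transpose ?M) $ i $ j = mink (?M $ i) (?M $ j)" for i j
    by (simp add: mink_def matrix_matrix_mult_def sum_4 gram_def transpose_def)
  then have "?M ** gram ** transpose ?M = gram"
    by (simp add: vec4_eq_iff gram_def frameD[OF assms])
  then have "det ?M * det gram * det ?M = det gram"
    by (metis det_mul det_transpose)
  then have "(volume_form x a b c)\<^sup>2 = 1"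
    by (simp add: det_gram volume_form_def power2_eq_square)
  then show ?thesis
    using frameD(18)[OF assms] by (simp add: power2_eq_1_iff)
qed

lemma frame_basis:
  assumes f: "(x, a, b, c) \<in> frames"
    and "mink x w = 0" "mink a w = 0" "mink b w = 0" "mink c w = 0"
  shows "w = 0"
proof -
  let ?M = "vector [x, a, b, c] :: real ^ 4 ^ 4"
  have "?M *v (gram *v w) = 0"
    using assms(2-5) by (simp add: vec4_eq_iff mink_gram matrix_vector_mul_component)
  moreover have "invertible ?M"
    using frame_volume[OF f] by (simp add: invertible_det_nz volume_form_def)
  ultimately have "gram *v w = 0"
    by (metis matrix_left_invertible_ker invertible_def)
  then have "mink y w = 0" for y
    by (simp add: mink_gram)
  then show ?thesis
    by (intro mink_nondegenerate) (simp add: mink_commute[of w])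
qed

lemma frame_hcross:
  assumes f: "(x, a, b, c) \<in> frames"
  shows "hcross x a b = c"
proof -
  have "hcross x a b - c = 0"
    by (rule frame_basis[OF f])
       (simp_all add: mink_commute[of _ "hcross x a b"] mink_hcross volume_form_alternating
         frame_volume[OF f] frameD[OF f])
  then show ?thesis by simp
qed

text \<open>These rearrangements are again right-handed. Through \<open>frame_hcross\<close> they yield every cross product
  that Rodrigues' formula needs.\<close>

lemma frame_swap:
  assumes "(x, a, b, c) \<in> frames"
  shows "(x, a, c, - b) \<in> frames" "(x, b, a, - c) \<in> frames"
  using frameD[OF assms] volume_form_swap[where x = x and a = a and b = b and c = c]
  by (simp_all add: frames_def unit_tangent_def)

lemma frame_hcross_swap:
  assumes f: "(x, a, b, c) \<in> frames"
  shows "hcross x a c = - b" "hcross x b a = - c"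
  using frame_swap[OF f] by (simp_all add: frame_hcross)

lemma translate_frame_in_frames:
  assumes f: "(x, a, b, c) \<in> frames"
  shows "translate_frame t (x, a, b, c) \<in> frames"
proof -
  have cs: "cosh t * cosh t = 1 + sinh t * sinh t"
    using cosh_square_eq[of t] by (simp add: power2_eq_square)
  have pos: "cosh t * x $ 1 + sinh t * a $ 1 > 0"
    using future_if_mink_neg[of x "cosh t *\<^sub>R x + sinh t *\<^sub>R a"] frameD[OF f] cs
    by (simp add: hyp3_def algebra_simps)
  have "volume_form (cosh t *\<^sub>R x + sinh t *\<^sub>R a) (sinh t *\<^sub>R x + cosh t *\<^sub>R a) b c
      = (cosh t * cosh t - sinh t * sinh t) * volume_form x a b c"
    by (rule volume_form_boost)
  then show ?thesis
    using pos frameD[OF f] cs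
    by (simp add: frames_def unit_tangent_def geodesic_def hyp3_def algebra_simps)
qed

lemma rotate_frame_in_frames:
  assumes f: "(x, a, b, c) \<in> frames"
  shows "rotate_frame first_vec t (x, a, b, c) = (x, a, cos t *\<^sub>R b + sin t *\<^sub>R c, cos t *\<^sub>R c - sin t *\<^sub>R b)"
    and "rotate_frame first_vec t (x, a, b, c) \<in> frames"
proof -
  show eq: "rotate_frame first_vec t (x, a, b, c) = (x, a, cos t *\<^sub>R b + sin t *\<^sub>R c, cos t *\<^sub>R c - sin t *\<^sub>R b)"
    using frameD[OF f]
    by (simp add: rotate_vec_def frame_hcross[OF f] frame_hcross_swap[OF f] hcross_linear algebra_simps)
  have cs: "cos t * cos t = 1 - sin t * sin t"
    using sin_cos_squared_add[of t] by (simp add: power2_eq_square)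
  have "volume_form x a (cos t *\<^sub>R b + sin t *\<^sub>R c) (cos t *\<^sub>R c - sin t *\<^sub>R b)
      = (cos t * cos t + sin t * sin t) * volume_form x a b c"
    by (rule volume_form_rotate)
  then show "rotate_frame first_vec t (x, a, b, c) \<in> frames"
    unfolding eq using frameD[OF f] cs
    by (simp add: frames_def unit_tangent_def algebra_simps)
qed


section \<open>Null flags and their spinors\<close>

type_synonym spinor = "complex \<times> complex"
type_synonym sym2 = "complex \<times> complex \<times> complex"

text \<open>The three complex numbers \<open>X\<close>, \<open>Y\<close>, \<open>Z\<close> are the components of \<open>E - \<i> B\<close>, where \<open>E\<close> and \<open>B\<close> are the
  electric and magnetic parts of the bivector \<open>p \<and> q\<close>. The triple \<open>(\<alpha>, \<beta>, \<gamma>)\<close> that is returned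
  stands for the symmetric matrix with rows \<open>(\<alpha>, \<beta>)\<close> and \<open>(\<beta>, \<gamma>)\<close>; its determinant is
  \<open>- (X\<^sup>2 + Y\<^sup>2 + Z\<^sup>2)\<close>, so null bivectors give the matrices of rank one, which are the squares of
  spinors. With \<open>E + \<i> B\<close> instead, a right-handed rotation about the first vector of a frame would
  act by \<open>exp (- \<i> \<theta>)\<close> and lambda lengths would appear conjugated.\<close>

definition self_dual :: "real ^ 4 \<Rightarrow> real ^ 4 \<Rightarrow> sym2" where
  "self_dual p q =
    (let X = of_real (p$1 * q$2 - p$2 * q$1) - \<i> * of_real (p$3 * q$4 - p$4 * q$3);
         Y = of_real (p$1 * q$3 - p$3 * q$1) - \<i> * of_real (p$4 * q$2 - p$2 * q$4);
         Z = of_real (p$1 * q$4 - p$4 * q$1) - \<i> * of_real (p$2 * q$3 - p$3 * q$2)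
     in (X + \<i> * Y, Z, \<i> * Y - X))"

definition spinor_square :: "spinor \<Rightarrow> sym2" where
  "spinor_square k = ((fst k)\<^sup>2, fst k * snd k, (snd k)\<^sup>2)"

definition spinor_det :: "spinor \<Rightarrow> spinor \<Rightarrow> complex" where
  "spinor_det k l = fst k * snd l - snd k * fst l"

definition null_cone :: "sym2 set" where
  "null_cone = {(p, q, r). p * r = q\<^sup>2} - {0}"

text \<open>The flag of a frame consists of the null vector \<open>x + a\<close>, which points to the end of the geodesic in
  the direction of the first vector, and of the half-plane at it on the side of the second vector.
  The bivector encodes both.\<close>

definition flag :: "frame \<Rightarrow> sym2" where
  "flag f = self_dual (fst f + first_vec f) (second_vec f)"

definition sym2_scale :: "complex \<Rightarrow> sym2 \<Rightarrow> sym2" where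
  "sym2_scale z s = (z * fst s, z * fst (snd s), z * snd (snd s))"

definition spinor_scale :: "complex \<Rightarrow> spinor \<Rightarrow> spinor" where
  "spinor_scale z k = (z * fst k, z * snd k)"

lemma sym2_scale_of_real: "sym2_scale (of_real t) s = t *\<^sub>R s"
  by (simp add: sym2_scale_def prod_eq_iff scaleR_conv_of_real)

lemma sym2_scale_complex:
  "sym2_scale (of_real p + \<i> * of_real q) s = p *\<^sub>R s + q *\<^sub>R sym2_scale \<i> s"
  by (simp add: sym2_scale_def prod_eq_iff scaleR_conv_of_real algebra_simps)

lemma spinor_square_scale: "spinor_square (spinor_scale z k) = sym2_scale (z\<^sup>2) (spinor_square k)"
  by (simp add: spinor_square_def spinor_scale_def sym2_scale_def power2_eq_square)

lemma spinor_det_scale: "spinor_det k (spinor_scale z l) = z * spinor_det k l"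
  by (simp add: spinor_det_def spinor_scale_def algebra_simps)

text \<open>The Pluecker relation for the \<open>2 \<times> 2\<close> minors of a \<open>2 \<times> 4\<close> matrix: the algebraic source of
  Ptolemy's equation.\<close>

lemma spinor_plucker:
  "spinor_det k0 k1 * spinor_det k2 k3 + spinor_det k0 k3 * spinor_det k1 k2
    = spinor_det k0 k2 * spinor_det k1 k3"
  by (simp add: spinor_det_def algebra_simps)

lemma self_dual_linear:
  "self_dual (p + p') q = self_dual p q + self_dual p' q" "self_dual p (q + q') = self_dual p q + self_dual p q'"
  "self_dual (p - p') q = self_dual p q - self_dual p' q" "self_dual p (q - q') = self_dual p q - self_dual p q'"
  "self_dual (t *\<^sub>R p) q = t *\<^sub>R self_dual p q" "self_dual p (t *\<^sub>R q) = t *\<^sub>R self_dual p q"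
  "self_dual (- p) q = - self_dual p q" "self_dual p (- q) = - self_dual p q" "self_dual p p = 0"
  by (simp_all add: self_dual_def Let_def prod_eq_iff complex_eq_iff algebra_simps)

lemma self_dual_swap: "self_dual q p = - self_dual p q"
  by (simp add: self_dual_def Let_def algebra_simps)

text \<open>The Hodge star acts on the self-dual part of a bivector as a scalar, and the star of
  \<open>m \<and> hcross x a b\<close> is, up to sign, the contraction of \<open>m\<close> with \<open>x \<and> a \<and> b\<close>.\<close>

lemma self_dual_hcross:
  "self_dual m (hcross x a b) =
    sym2_scale (- \<i>) (mink m x *\<^sub>R self_dual a b + mink m a *\<^sub>R self_dual b x + mink m b *\<^sub>R self_dual x a)"
  by (simp add: sym2_scale_def self_dual_def Let_def hcross_expand mink_def complex_eq_iff algebra_simps)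

text \<open>The polarised determinant, up to a factor. On bivectors it is twice the complex form
  \<open>X X' + Y Y' + Z Z'\<close>, whose real part is the Minkowski product of bivectors and whose imaginary part
  is their wedge product, both up to sign.\<close>

definition sym2_dot :: "sym2 \<Rightarrow> sym2 \<Rightarrow> complex" where
  "sym2_dot s t = 2 * fst (snd s) * fst (snd t) - fst s * snd (snd t) - snd (snd s) * fst t"

lemma sym2_dot_self_dual:
  "sym2_dot (self_dual p q) (self_dual r s) =
    of_real (2 * (mink p s * mink q r - mink p r * mink q s)) - 2 * \<i> * of_real (volume_form p q r s)"
  by (simp add: sym2_dot_def self_dual_def Let_def mink_def volume_form_expand complex_eq_iff algebra_simps)

text \<open>The matrix \<open>g J\<close>, with \<open>J\<close> the standard symplectic matrix, is traceless when \<open>g\<close> is symmetric. In this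
  way bivectors, the infinitesimal isometries, act on spinors; \<open>sym2_bracket\<close> is half of the induced
  derivation on symmetric matrices.\<close>

definition sl2_act :: "sym2 \<Rightarrow> spinor \<Rightarrow> spinor" where
  "sl2_act g k = (fst (snd g) * fst k - fst g * snd k, snd (snd g) * fst k - fst (snd g) * snd k)"

definition sym2_bracket :: "sym2 \<Rightarrow> sym2 \<Rightarrow> sym2" where
  "sym2_bracket g s =
    (fst (snd g) * fst s - fst g * fst (snd s),
     (snd (snd g) * fst s - fst g * snd (snd s)) / 2,
     snd (snd g) * fst (snd s) - fst (snd g) * snd (snd s))"

text \<open>The bracket of bivectors in the Lie algebra of the Lorentz group.\<close>

lemma sym2_bracket_self_dual:
  "sym2_bracket (self_dual p q) (self_dual r s) =
    mink q r *\<^sub>R self_dual p s - mink p r *\<^sub>R self_dual q s + mink p s *\<^sub>R self_dual q r - mink q s *\<^sub>R self_dual p r"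
  by (simp add: sym2_bracket_def self_dual_def Let_def mink_def complex_eq_iff field_simps)


lemma sl2_act_bracket:
  "2 * (fst k * fst (sl2_act g k)) = 2 * fst (sym2_bracket g (spinor_square k))"
  "fst k * snd (sl2_act g k) + snd k * fst (sl2_act g k) = 2 * fst (snd (sym2_bracket g (spinor_square k)))"
  "2 * (snd k * snd (sl2_act g k)) = 2 * snd (snd (sym2_bracket g (spinor_square k)))"
  by (simp_all add: sl2_act_def sym2_bracket_def spinor_square_def power2_eq_square algebra_simps)

text \<open>With \<open>G = g J\<close>, applying the derivation \<open>S \<mapsto> G S + S G\<^sup>T\<close> twice gives
  \<open>2 G S G\<^sup>T + G\<^sup>2 S + S (G\<^sup>T)\<^sup>2\<close>, and \<open>G\<^sup>2\<close> is a scalar because \<open>G\<close> is traceless.\<close>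

lemma spinor_square_sl2_act:
  "spinor_square (sl2_act g k) =
    2 *\<^sub>R sym2_bracket g (sym2_bracket g (spinor_square k))
    - sym2_scale (sym2_dot g g / 2) (spinor_square k)"
  by (simp add: prod_eq_iff spinor_square_def sl2_act_def sym2_bracket_def sym2_scale_def sym2_dot_def
      scaleR_conv_of_real power2_eq_square field_simps)

text \<open>Self-duality turns the quarter rotation of the second vector about the first into multiplication of
  the flag by \<open>\<i>\<close>; hence rotation by \<open>\<theta>\<close> multiplies it by \<open>exp (\<i> \<theta>)\<close> and its spinor by
  \<open>exp (\<i> \<theta> / 2)\<close>.\<close>

lemma frame_flag_third:
  assumes f: "(x, a, b, c) \<in> frames"
  shows "self_dual (x + a) c = sym2_scale \<i> (self_dual (x + a) b)"
  unfolding frame_hcross[OF f, symmetric] self_dual_hcross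
  using frameD[OF f]
  by (simp add: self_dual_linear sym2_scale_def self_dual_swap[of x b] algebra_simps)

text \<open>The flag cannot vanish, because its pairing with the opposite flag, built on \<open>x - a\<close>, is not zero.\<close>

lemma flag_in_null_cone:
  assumes f: "f \<in> frames"
  shows "flag f \<in> null_cone"
proof -
  obtain x a b c where fe: "f = (x, a, b, c)" by (cases f)
  note D = frameD[OF f[unfolded fe]]
  have "sym2_dot (self_dual (x + a) b) (self_dual (x + a) b) = 0"
    unfolding sym2_dot_self_dual using D by (simp add: volume_form_alternating)
  moreover have "sym2_dot (self_dual (x - a) b) (self_dual (x + a) b) \<noteq> 0"
    unfolding sym2_dot_self_dual using D by (simp add: complex_eq_iff)
  ultimately show ?thesis
    by (auto simp: flag_def fe null_cone_def sym2_dot_def power2_eq_square split: prod.splits)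
qed

text \<open>The determinant of a spinor and its image under a generator is linear in the square of the spinor, so
  it is a function of the frame alone; only the volume term survives in it. In particular it has the
  same sign for both spinors of the flag and for all frames.\<close>

lemma frame_spinor_det:
  assumes f: "(x, a, b, c) \<in> frames" and k: "spinor_square k = self_dual (x + a) b"
  shows "spinor_det k (sl2_act (self_dual a c) k) = - 2 * \<i>"
proof -
  have "spinor_det k (sl2_act (self_dual a c) k) = - sym2_dot (self_dual a c) (spinor_square k)"
    by (simp add: spinor_det_def sl2_act_def sym2_dot_def spinor_square_def power2_eq_square algebra_simps)
  also have "\<dots> = 2 * \<i> * of_real (volume_form a c (x + a) b)"
    unfolding k sym2_dot_self_dual using frameD[OF f] by simp
  also have "volume_form a c (x + a) b = - volume_form x a b c"
    by (simp add: volume_form_expand algebra_simps)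
  finally show ?thesis
    by (simp add: frame_volume[OF f])
qed

text \<open>Rotation about the second vector is the one-parameter group of the bivector \<open>a \<and> c\<close>, whose action on
  spinors squares to \<open>-1\<close>. The spinor therefore turns with half the angle, from the spinor of the flag
  at \<open>x + a\<close> to that of the flag at \<open>x - a\<close>.\<close>

lemma frame_spinor_rotate:
  assumes f: "(x, a, b, c) \<in> frames" and k: "spinor_square k = self_dual (x + a) b"
  shows "spinor_square (cos (t / 2) *\<^sub>R k + sin (t / 2) *\<^sub>R sl2_act (self_dual a c) k)
    = self_dual (x + cos t *\<^sub>R a - sin t *\<^sub>R c) b"
proof -
  let ?e = "sl2_act (self_dual a c) k" and ?g = "self_dual a c"
  have S: "sym2_bracket ?g (self_dual (x + a) b) = - self_dual c b"
    unfolding sym2_bracket_self_dual using frameD[OF f] by (simp add: self_dual_linear)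
  have "sym2_bracket ?g (- self_dual c b) = - self_dual a b"
    unfolding self_dual_linear(7)[symmetric] sym2_bracket_self_dual using frameD[OF f] by (simp add: self_dual_linear)
  moreover have "sym2_dot ?g ?g = - 2"
    unfolding sym2_dot_self_dual using frameD[OF f] by (simp add: volume_form_alternating)
  ultimately have e: "spinor_square ?e = self_dual (x - a) b"
    unfolding spinor_square_sl2_act k S
    by (simp add: self_dual_linear sym2_scale_def prod_eq_iff scaleR_2)
  have double: "self_dual (x + (p\<^sup>2 - q\<^sup>2) *\<^sub>R a - (2 * q * p) *\<^sub>R c) b
      = p\<^sup>2 *\<^sub>R self_dual (x + a) b + q\<^sup>2 *\<^sub>R self_dual (x - a) b - (2 * q * p) *\<^sub>R self_dual c b"
    if "p\<^sup>2 + q\<^sup>2 = 1" for p q :: real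
  proof -
    have "self_dual x b = (p\<^sup>2 + q\<^sup>2) *\<^sub>R self_dual x b" using that by simp
    then show ?thesis by (simp add: self_dual_linear algebra_simps)
  qed
  have t: "cos t = (cos (t / 2))\<^sup>2 - (sin (t / 2))\<^sup>2" "sin t = 2 * sin (t / 2) * cos (t / 2)"
    using cos_double[of "t / 2"] sin_double[of "t / 2"] by simp_all
  have "self_dual (x + cos t *\<^sub>R a - sin t *\<^sub>R c) b
    = (cos (t / 2))\<^sup>2 *\<^sub>R self_dual (x + a) b + (sin (t / 2))\<^sup>2 *\<^sub>R self_dual (x - a) b
      - (2 * sin (t / 2) * cos (t / 2)) *\<^sub>R self_dual c b"
    unfolding t by (rule double) simp
  also have "\<dots> = spinor_square (cos (t / 2) *\<^sub>R k + sin (t / 2) *\<^sub>R ?e)"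
  proof -
    have S1: "fst k * fst ?e = - fst (self_dual c b)"
      "fst k * snd ?e + snd k * fst ?e = - 2 * fst (snd (self_dual c b))"
      "snd k * snd ?e = - snd (snd (self_dual c b))"
      using sl2_act_bracket[of k ?g] unfolding k S by simp_all
    have comb: "p\<^sup>2 *\<^sub>R spinor_square k + q\<^sup>2 *\<^sub>R spinor_square l - (2 * q * p) *\<^sub>R s
        = spinor_square (p *\<^sub>R k + q *\<^sub>R l)"
      if "fst k * fst l = - fst s" "fst k * snd l + snd k * fst l = - 2 * fst (snd s)"
        "snd k * snd l = - snd (snd s)" for p q k l s
    proof -
      have "fst s = - (fst k * fst l)" "2 * fst (snd s) = - (fst k * snd l + snd k * fst l)"
        "snd (snd s) = - (snd k * snd l)"
        using that by simp_all
      then show ?thesis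
        by (simp add: prod_eq_iff spinor_square_def scaleR_conv_of_real) algebra
    qed
    show ?thesis
      unfolding k[symmetric] e[symmetric] by (rule comb[OF S1])
  qed
  finally show ?thesis ..
qed


section \<open>Covering spaces\<close>

lemma spinor_square_surj:
  assumes "s \<in> null_cone"
  obtains k where "k \<noteq> 0" "spinor_square k = s"
proof -
  obtain p q r where s: "s = (p, q, r)" by (cases s)
  have pr: "p * r = q\<^sup>2" and nz: "p \<noteq> 0 \<or> q \<noteq> 0 \<or> r \<noteq> 0"
    using assms by (auto simp: s null_cone_def zero_prod_def)
  show thesis
  proof (cases "p = 0")
    case True
    then show thesis
      using pr nz by (intro that[of "(0, csqrt r)"]) (auto simp: s spinor_square_def zero_prod_def)
  next
    case False
    have "(q / csqrt p)\<^sup>2 = r"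
      using False pr by (simp add: power_divide field_simps)
    then show thesis
      using False by (intro that[of "(csqrt p, q / csqrt p)"]) (auto simp: s spinor_square_def zero_prod_def)
  qed
qed

lemma spinor_square_in_null_cone: "k \<noteq> 0 \<Longrightarrow> spinor_square k \<in> null_cone"
  by (auto simp: spinor_square_def null_cone_def zero_prod_def prod_eq_iff power_mult_distrib)

text \<open>Two-sheetedness is explicit: if a linear form \<open>l\<close> does not vanish at a spinor \<open>k\<close>, then \<open>k\<close> is
  recovered from \<open>k k\<^sup>T\<close> by contracting with \<open>l\<close> and dividing by \<open>l k\<close>, which is a square root of
  the value of \<open>l \<otimes> l\<close> on \<open>k k\<^sup>T\<close>. A branch of this root exists wherever that value has positive
  real part.\<close>

lemma covering_space_spinor_square: "covering_space (- {0}) spinor_square null_cone"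
proof
  show cont: "continuous_on (- {0}) spinor_square"
    unfolding spinor_square_def by (intro continuous_intros)
  show "spinor_square ` (- {0}) = null_cone"
  proof
    show "spinor_square ` (- {0}) \<subseteq> null_cone"
      by (intro image_subsetI spinor_square_in_null_cone) simp
    show "null_cone \<subseteq> spinor_square ` (- {0})"
    proof
      fix s assume "s \<in> null_cone"
      then obtain k where "k \<noteq> 0" "spinor_square k = s" by (rule spinor_square_surj)
      then show "s \<in> spinor_square ` (- {0})" by blast
    qed
  qed
  fix s assume "s \<in> null_cone"
  then obtain k0 where k0: "k0 \<noteq> 0" "spinor_square k0 = s"
    by (rule spinor_square_surj)
  \<comment> \<open>the linear form, with coefficients \<open>A\<close> and \<open>B\<close>, is normalised to 1 at \<open>k0\<close>, so that \<open>s\<close> lies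
      in the region of positive real part\<close>
  obtain A B :: complex where AB: "A * fst k0 + B * snd k0 = 1"
  proof (cases "fst k0 = 0")
    case True
    then have "0 * fst k0 + (1 / snd k0) * snd k0 = 1"
      using k0(1) by (simp add: prod_eq_iff)
    then show thesis by (rule that)
  next
    case False
    then have "(1 / fst k0) * fst k0 + 0 * snd k0 = 1" by simp
    then show thesis by (rule that)
  qed
  define l where "l = (\<lambda>k :: spinor. A * fst k + B * snd k)"
  define m where "m = (\<lambda>s :: sym2. A\<^sup>2 * fst s + 2 * A * B * fst (snd s) + B\<^sup>2 * snd (snd s))"
  define q where "q = (\<lambda>s :: sym2. ((A * fst s + B * fst (snd s)) / csqrt (m s),
      (A * fst (snd s) + B * snd (snd s)) / csqrt (m s)))"
  define T where "T = {s \<in> null_cone. Re (m s) > 0}"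
  define U where "U = {k \<in> - {0}. Re (m (spinor_square k)) > 0 \<and> Re (l k) > 0}"
  define U' where "U' = {k \<in> - {0}. Re (m (spinor_square k)) > 0 \<and> Re (l k) < 0}"
  have ml: "m (spinor_square k) = (l k)\<^sup>2" for k
    by (simp add: m_def l_def spinor_square_def power2_eq_square algebra_simps)
  have contm: "continuous_on X m" for X
    unfolding m_def by (intro continuous_intros)
  have contl: "continuous_on X l" for X
    unfolding l_def by (intro continuous_intros)
  have contsq: "continuous_on X spinor_square" for X
    unfolding spinor_square_def by (intro continuous_intros)
  have l_nz: "Re (l k) \<noteq> 0" if "Re ((l k)\<^sup>2) > 0" for k
    using that by (auto simp: power2_eq_square)
  have csq: "csqrt (m (spinor_square k)) = (if Re (l k) > 0 then l k else - l k)"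
    if "Re ((l k)\<^sup>2) > 0" for k
    using l_nz[OF that] csqrt_square[of "l k"] csqrt_square[of "- l k"] unfolding ml
    by auto
  have qsq: "q (spinor_square k) = (if Re (l k) > 0 then k else - k)"
    if "Re ((l k)\<^sup>2) > 0" for k
  proof -
    have "l k \<noteq> 0" using that by auto
    moreover have "A * (fst k)\<^sup>2 + B * (fst k * snd k) = fst k * l k"
      "A * (fst k * snd k) + B * (snd k)\<^sup>2 = snd k * l k"
      by (simp_all add: l_def power2_eq_square algebra_simps)
    ultimately show ?thesis
      unfolding q_def csq[OF that] by (simp add: spinor_square_def prod_eq_iff)
  qed
  have contq: "continuous_on T q"
    unfolding q_def using contm
    by (intro continuous_intros continuous_on_compose2[OF continuous_on_csqrt])
       (auto simp: T_def complex_nonpos_Reals_iff)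
  have l_neg: "l (- k) = - l k" and sq_neg: "spinor_square (- k) = spinor_square k" for k
    by (simp_all add: l_def spinor_square_def)
  have hom: "homeomorphism U T spinor_square q"
  proof (rule homeomorphismI)
    show "continuous_on U spinor_square" by (rule contsq)
    show "continuous_on T q" by (rule contq)
    show "spinor_square ` U \<subseteq> T"
      by (auto simp: U_def T_def spinor_square_in_null_cone)
    show 1: "q (spinor_square k) = k" if "k \<in> U" for k
      using that qsq[of k] by (auto simp: U_def ml)
    have *: "\<exists>k \<in> U. spinor_square k = s" if "s \<in> T" for s
    proof -
      from that obtain k where k: "k \<noteq> 0" "spinor_square k = s"
        by (auto simp: T_def elim: spinor_square_surj)
      then have "Re ((l k)\<^sup>2) > 0" using that by (auto simp: T_def ml[symmetric])
      from l_nz[OF this] this k have "k \<in> U \<or> - k \<in> U"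
        by (auto simp: U_def l_neg sq_neg ml)
      then show ?thesis
      proof
        assume "- k \<in> U"
        then show ?thesis using k sq_neg[of k] by (intro bexI[of _ "- k"]) auto
      qed (use k in auto)
    qed
    show "spinor_square (q s) = s" if "s \<in> T" for s
      using *[OF that] 1 by auto
    show "q ` T \<subseteq> U"
      using * 1 by (metis image_subsetI)
  qed
  have U': "U' = uminus ` U"
  proof
    show "U' \<subseteq> uminus ` U"
    proof
      fix k assume "k \<in> U'"
      then have "- k \<in> U" by (auto simp: U_def U'_def l_neg sq_neg)
      then show "k \<in> uminus ` U" by (rule image_eqI[rotated]) simp
    qed
    show "uminus ` U \<subseteq> U'"
    proof (rule image_subsetI)
      fix k assume "k \<in> U"
      then show "- k \<in> U'" by (simp add: U_def U'_def l_neg sq_neg del: split_paired_All)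
    qed
  qed
  have hom': "homeomorphism U' T spinor_square (\<lambda>s. - q s)"
  proof (rule homeomorphismI)
    show "continuous_on U' spinor_square" by (rule contsq)
    show "continuous_on T (\<lambda>s. - q s)" by (intro continuous_intros contq)
    show "spinor_square ` U' \<subseteq> T"
      unfolding U' image_image sq_neg using homeomorphism_image1[OF hom] by simp
    show "(\<lambda>s. - q s) ` T \<subseteq> U'"
      unfolding U' using homeomorphism_image2[OF hom] by blast
    show "- q (spinor_square k) = k" if k: "k \<in> U'" for k
    proof -
      obtain k' where "k' \<in> U" "k = - k'" using k U' by blast
      then show ?thesis using homeomorphism_apply1[OF hom, of k'] sq_neg[of k'] by simp
    qed
    show "spinor_square (- q s) = s" if "s \<in> T" for s
      unfolding sq_neg by (rule homeomorphism_apply2[OF hom that])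
  qed
  have "openin (top_of_set null_cone) T"
    unfolding T_def openin_open
    by (intro exI[of _ "{s. Re (m s) > 0}"] conjI open_Collect_less continuous_intros contm) auto
  moreover have U_open: "\<forall>u\<in>{U, U'}. openin (top_of_set (- {0})) u"
  proof -
    have "U = - {0} \<inter> ({k. Re (m (spinor_square k)) > 0} \<inter> {k. Re (l k) > 0})"
      "U' = - {0} \<inter> ({k. Re (m (spinor_square k)) > 0} \<inter> {k. Re (l k) < 0})"
      by (auto simp: U_def U'_def)
    then have "open U" "open U'"
      by (auto intro!: open_Int open_Collect_less continuous_intros contl
          continuous_on_compose2[OF contm contsq])
    moreover have "U \<subseteq> - {0}" "U' \<subseteq> - {0}" by (auto simp: U_def U'_def)
    ultimately show ?thesis by (simp add: openin_open_eq open_Compl)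
  qed
  moreover have "s \<in> T"
    using \<open>s \<in> null_cone\<close> k0 AB ml[of k0] by (auto simp: T_def l_def)
  moreover have "\<Union> {U, U'} = - {0} \<inter> spinor_square -` T"
    using l_nz by (auto simp: U_def U'_def T_def spinor_square_in_null_cone ml) (metis linorder_neqE_linordered_idom)
  moreover have "pairwise disjnt {U, U'}"
    by (auto simp: pairwise_def disjnt_def U_def U'_def)
  ultimately show "\<exists>T. s \<in> T \<and> openin (top_of_set null_cone) T \<and>
      (\<exists>v. \<Union> v = - {0} \<inter> spinor_square -` T \<and> (\<forall>u\<in>v. openin (top_of_set (- {0})) u) \<and>
        pairwise disjnt v \<and> (\<forall>u\<in>v. \<exists>q. homeomorphism u T spinor_square q))"
    using hom hom' U_open by (intro exI[of _ T] conjI exI[of _ "{U, U'}"]) blast+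
qed

text \<open>Path lifting when the total space is any topological space, as the bundle of spin frames is. Lifts
  over adjacent intervals can be glued and lifts exist over short intervals, so bisection applies.\<close>

lemma covering_space_path_lift:
  assumes cov: "covering_space C p S" and g: "continuous_on {0..1} g" "g \<in> {0..1::real} \<rightarrow> S"
    and c: "c \<in> C" "p c = g 0"
  obtains h where "continuous_on {0..1} h" "h \<in> {0..1} \<rightarrow> C" "h 0 = c"
    "\<And>t. t \<in> {0..1} \<Longrightarrow> p (h t) = g t"
proof -
  define P where "P = (\<lambda>(u, v). 0 \<le> u \<longrightarrow> u \<le> v \<longrightarrow> v \<le> 1 \<longrightarrow> (\<forall>c\<in>C. p c = g u \<longrightarrow>
    (\<exists>h. continuous_on {u..v} h \<and> h \<in> {u..v} \<rightarrow> C \<and> h u = c \<and> (\<forall>t\<in>{u..v}. p (h t) = g t))))"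
  have "P (0, 1)"
  proof (rule Bolzano[of 0 1 "\<lambda>u v. P (u, v)"])
    show "(0::real) \<le> 1" by simp
  next
    fix u v w assume P: "P (u, v)" "P (v, w)" and le: "u \<le> v" "v \<le> w"
    show "P (u, w)"
      unfolding P_def prod.case
    proof (intro impI ballI)
      fix c assume a: "0 \<le> u" "u \<le> w" "w \<le> 1" "c \<in> C" "p c = g u"
      obtain h where h: "continuous_on {u..v} h" "h \<in> {u..v} \<rightarrow> C" "h u = c" "\<forall>t\<in>{u..v}. p (h t) = g t"
        using P(1) a le unfolding P_def by auto
      have "h v \<in> C" "p (h v) = g v" using h le by auto
      then obtain h' where h': "continuous_on {v..w} h'" "h' \<in> {v..w} \<rightarrow> C" "h' v = h v"
        "\<forall>t\<in>{v..w}. p (h' t) = g t"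
        using P(2) a le unfolding P_def by auto
      have un: "{u..w} = {u..v} \<union> {v..w}" using le by auto
      let ?k = "\<lambda>t. if t \<le> v then h t else h' t"
      have "continuous_on {u..w} ?k"
        unfolding un using h h'
        by (intro continuous_on_If) auto
      moreover have "?k t \<in> C \<and> p (?k t) = g t" if "t \<in> {u..w}" for t
      proof (cases "t \<le> v")
        case True
        then have "t \<in> {u..v}" using that by simp
        then show ?thesis using h True by auto
      next
        case False
        then have "t \<in> {v..w}" using that by simp
        then show ?thesis using h' False by auto
      qed
      ultimately show "\<exists>h. continuous_on {u..w} h \<and> h \<in> {u..w} \<rightarrow> C \<and> h u = c \<and> (\<forall>t\<in>{u..w}. p (h t) = g t)"
        using h(3) le by (intro exI[of _ ?k]) auto
    qed
  next
    fix x :: real assume x: "0 \<le> x" "x \<le> 1"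
    then have "g x \<in> S" using g by auto
    then obtain T V where T: "g x \<in> T" "openin (top_of_set S) T" "\<Union> V = C \<inter> p -` T"
      "\<forall>u\<in>V. \<exists>q. homeomorphism u T p q"
      using cov unfolding covering_space_def by meson
    obtain T' where T': "open T'" "T = S \<inter> T'" using T(2) by (auto simp: openin_open)
    obtain W where W: "open W" "x \<in> W" "\<forall>y\<in>{0..1} \<inter> W. g y \<in> T'"
      using g(1) x T(1) T' unfolding continuous_on_topological by (metis Int_iff atLeastAtMost_iff)
    obtain d where d: "d > 0" "ball x d \<subseteq> W" using W openE by blast
    show "\<exists>d>0. \<forall>u v. u \<le> x \<and> x \<le> v \<and> v - u < d \<longrightarrow> P (u, v)"
      unfolding P_def prod.case
    proof (intro exI[of _ d] conjI allI impI ballI)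
      fix u v c assume a: "u \<le> x \<and> x \<le> v \<and> v - u < d" "0 \<le> u" "u \<le> v" "v \<le> 1" "c \<in> C" "p c = g u"
      have gT: "g t \<in> T" if "t \<in> {u..v}" for t
      proof -
        have "t \<in> ball x d" using that a by (auto simp: dist_real_def)
        then show ?thesis using W(3) d(2) g(2) that a T' by auto
      qed
      then have "c \<in> \<Union> V" using T(3) a by auto
      then obtain u' q where u': "c \<in> u'" "u' \<in> V" and hom: "homeomorphism u' T p q"
        using T(4) by blast
      have "continuous_on {u..v} (q \<circ> g)"
      proof (rule continuous_on_compose)
        show "continuous_on {u..v} g" using a by (intro continuous_on_subset[OF g(1)]) auto
        show "continuous_on (g ` {u..v}) q"
          using homeomorphism_cont2[OF hom] by (rule continuous_on_subset) (use gT in blast)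
      qed
      then show "\<exists>h. continuous_on {u..v} h \<and> h \<in> {u..v} \<rightarrow> C \<and> h u = c \<and> (\<forall>t\<in>{u..v}. p (h t) = g t)"
      proof (intro exI conjI ballI)
        show "q \<circ> g \<in> {u..v} \<rightarrow> C"
        proof
          fix t assume "t \<in> {u..v}"
          then have "q (g t) \<in> u'" using homeomorphism_image2[OF hom] gT by blast
          then show "(q \<circ> g) t \<in> C" using T(3) u'(2) by auto
        qed
        show "(q \<circ> g) u = c"
          using homeomorphism_apply1[OF hom u'(1)] a by simp
        show "p ((q \<circ> g) t) = g t" if "t \<in> {u..v}" for t
          using homeomorphism_apply2[OF hom gT[OF that]] by simp
      qed
    qed (fact d(1))
  qed
  then show thesis using that c unfolding P_def by auto
qed

lemma constant_path:
  fixes s :: "'s::topological_space"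
  shows "path (\<lambda>_. s)" "path_image (\<lambda>_. s) = {s}" "pathstart (\<lambda>_. s) = s" "pathfinish (\<lambda>_. s) = s"
  by (simp_all add: path_def path_image_def pathstart_def pathfinish_def)

lemma simply_connected_path:
  fixes U :: "'s::topological_space set"
  assumes "simply_connected U" "s \<in> U" "t \<in> U"
  obtains g where "path g" "path_image g \<subseteq> U" "pathstart g = s" "pathfinish g = t"
proof -
  have "homotopic_loops U (\<lambda>_. s) (\<lambda>_. t)"
    by (intro assms(1)[unfolded simply_connected_def, rule_format]) (simp add: constant_path assms)
  then obtain h where h: "continuous_on ({0..1} \<times> {0..1}) h" "h \<in> {0..1} \<times> {0..1} \<rightarrow> U"
    "\<forall>x\<in>{0..1::real}. h (0::real, x) = s" "\<forall>x\<in>{0..1}. h (1, x) = t"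
    by (auto simp: homotopic_loops image_subset_iff_funcset)
  show thesis
  proof (rule that[of "\<lambda>r. h (r, 0)"])
    show "path (\<lambda>r. h (r, 0))"
      unfolding path_def by (rule continuous_on_compose2[OF h(1)]) (auto intro!: continuous_intros)
  qed (use h in \<open>auto simp: path_image_def pathstart_def pathfinish_def\<close>)
qed

text \<open>Transport along paths from a base point defines the lift; simple connectedness of \<open>U\<close> and the
  monodromy theorem make it independent of the path. The lift is continuous along paths, and spin frames
  are only ever compared along paths.\<close>

lemma covering_space_lift_along_paths:
  fixes p :: "'a::real_normed_vector \<Rightarrow> 'b::real_normed_vector"
    and U :: "'s::topological_space set"
  assumes cov: "covering_space C p S" and sc: "simply_connected U"
    and f: "continuous_on U f" "f \<in> U \<rightarrow> S"
  obtains k where "\<And>s. s \<in> U \<Longrightarrow> k s \<in> C \<and> p (k s) = f s"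
    "\<And>g. path g \<Longrightarrow> path_image g \<subseteq> U \<Longrightarrow> path (k \<circ> g)"
proof (cases "U = {}")
  case True
  then show thesis by (intro that[of undefined]) (auto simp: path_image_def)
next
  case False
  then obtain s0 where s0: "s0 \<in> U" by auto
  then obtain c0 where c0: "c0 \<in> C" "p c0 = f s0"
    using cov f by (metis PiE covering_space_imp_surjective imageE)
  have comp: "path (f \<circ> g)" "path_image (f \<circ> g) \<subseteq> S" if "path g" "path_image g \<subseteq> U" for g
    using that f continuous_on_subset[OF f(1)] 
    by (auto simp: path_image_compose intro!: path_continuous_image)
  define R where "R = (\<lambda>s c. \<exists>g h. path g \<and> path_image g \<subseteq> U \<and> pathstart g = s0 \<and> pathfinish g = s \<and>
      path h \<and> path_image h \<subseteq> C \<and> pathstart h = c0 \<and> pathfinish h = c \<and>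
      (\<forall>t\<in>{0..1}. p (h t) = f (g t)))"
  have uniq: "c = c'" if R: "R s c" "R s c'" for s c c'
  proof -
    obtain g h where g: "path g" "path_image g \<subseteq> U" "pathstart g = s0" "pathfinish g = s"
      "path h" "path_image h \<subseteq> C" "pathstart h = c0" "pathfinish h = c" "\<forall>t\<in>{0..1}. p (h t) = f (g t)"
      using R(1) unfolding R_def by blast
    obtain g' h' where g': "path g'" "path_image g' \<subseteq> U" "pathstart g' = s0" "pathfinish g' = s"
      "path h'" "path_image h' \<subseteq> C" "pathstart h' = c0" "pathfinish h' = c'" "\<forall>t\<in>{0..1}. p (h' t) = f (g' t)"
      using R(2) unfolding R_def by blast
    have "homotopic_loops U (g +++ reversepath g') (\<lambda>_. s0)"
      using s0 g g'
      by (intro sc[unfolded simply_connected_def, rule_format]) (simp add: constant_path path_image_join)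
    then have "homotopic_loops S (f \<circ> (g +++ reversepath g')) (f \<circ> (\<lambda>_. s0))"
      by (rule homotopic_loops_continuous_image) (fact f)+
    moreover have "f \<circ> (g +++ reversepath g') = (f \<circ> g) +++ reversepath (f \<circ> g')"
      by (auto simp: joinpaths_def reversepath_def)
    moreover have "f \<circ> (\<lambda>_. s0) = linepath (f s0) (f s0)"
      by (auto simp: linepath_def algebra_simps)
    ultimately have "homotopic_paths S (f \<circ> g) (f \<circ> g')"
      using homotopic_paths_loop_parts[of S "f \<circ> g" "f \<circ> g'"] comp[OF g'(1,2)] by auto
    then have "pathfinish h = pathfinish h'"
      using comp[OF g(1,2)] comp[OF g'(1,2)] g g'
      by (intro covering_space_monodromy[OF cov _ _ _ _ _ _ _ _ _ _ _ , of "f \<circ> g" "f \<circ> g'"]) auto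
    then show ?thesis using g g' by simp
  qed
  have lift: "\<exists>h. path h \<and> path_image h \<subseteq> C \<and> pathstart h = c \<and> (\<forall>t\<in>{0..1}. p (h t) = f (g t))"
    if "path g" "path_image g \<subseteq> U" "c \<in> C" "p c = f (pathstart g)" for g c
  proof -
    have "continuous_on {0..1} (f \<circ> g)" "f \<circ> g \<in> {0..1} \<rightarrow> S" "p c = (f \<circ> g) 0"
      using comp[OF that(1,2)] that by (auto simp: path_def path_image_def pathstart_def)
    from covering_space_path_lift[OF cov this(1,2) that(3) this(3)] obtain h where
      "continuous_on {0..1} h" "h \<in> {0..1} \<rightarrow> C" "h 0 = c" "\<And>t. t \<in> {0..1} \<Longrightarrow> p (h t) = (f \<circ> g) t"
      by blast
    then show ?thesis
      by (intro exI[of _ h]) (auto simp: path_def path_image_def pathstart_def)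
  qed
  have ex: "\<exists>c. R s c" if s: "s \<in> U" for s
  proof -
    obtain g where g: "path g" "path_image g \<subseteq> U" "pathstart g = s0" "pathfinish g = s"
      using simply_connected_path[OF sc s0 s] by blast
    from lift[OF g(1,2) c0(1)] c0 g show ?thesis unfolding R_def by metis
  qed
  define k where "k = (\<lambda>s. SOME c. R s c)"
  have k: "R s (k s)" if "s \<in> U" for s
    using ex[OF that] unfolding k_def by (rule someI_ex)
  have kC: "k s \<in> C \<and> p (k s) = f s" if s: "s \<in> U" for s
  proof -
    obtain g h where "pathfinish g = s" "path_image h \<subseteq> C" "pathfinish h = k s"
      "\<forall>t\<in>{0..1}. p (h t) = f (g t)"
      using k[OF s] unfolding R_def by blast
    then show ?thesis
      by (metis atLeastAtMost_iff order_refl pathfinish_def pathfinish_in_path_image subsetD zero_le_one)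
  qed
  have "path (k \<circ> g)" if g: "path g" "path_image g \<subseteq> U" for g
  proof -
    have gU: "g t \<in> U" if "t \<in> {0..1}" for t
      using g(2) that by (auto simp: path_image_def)
    have U0: "pathstart g \<in> U" using gU[of 0] by (simp add: pathstart_def)
    obtain h where h: "path h" "path_image h \<subseteq> C" "pathstart h = k (pathstart g)" "\<forall>t\<in>{0..1}. p (h t) = f (g t)"
      using lift[OF g, of "k (pathstart g)"] kC[OF U0] by auto
    obtain g0 h0 where g0: "path g0" "path_image g0 \<subseteq> U" "pathstart g0 = s0" "pathfinish g0 = pathstart g"
      "path h0" "path_image h0 \<subseteq> C" "pathstart h0 = c0" "pathfinish h0 = k (pathstart g)"
      "\<forall>t\<in>{0..1}. p (h0 t) = f (g0 t)"
      using k[OF U0] unfolding R_def by blast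
    have "k (g t) = h t" if t: "t \<in> {0..1}" for t
    proof (rule uniq)
      show "R (g t) (k (g t))" using k gU t by simp
      let ?g = "\<lambda>r. g (t * r)" and ?h = "\<lambda>r. h (t * r)"
      have tr: "t * r \<in> {0..1}" if "r \<in> {0..1}" for r
        using t that by (auto simp: mult_le_one)
      have "path ?g" "path ?h"
        unfolding path_def
        by (rule continuous_on_compose2[OF g(1)[unfolded path_def]]
            continuous_on_compose2[OF h(1)[unfolded path_def]], rule continuous_on_mult_const, use tr in blast)+
      moreover have "path_image ?g \<subseteq> U" "path_image ?h \<subseteq> C"
        using gU tr h(2) by (auto simp: path_image_def)
      moreover have "pathstart ?g = pathstart g" "pathstart ?h = k (pathstart g)"
        "pathfinish ?g = g t" "pathfinish ?h = h t"
        using h(3) by (auto simp: pathstart_def pathfinish_def)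
      moreover have "p ((h0 +++ ?h) r) = f ((g0 +++ ?g) r)" if "r \<in> {0..1}" for r
        using that g0(9) h(4) tr by (auto simp: joinpaths_def)
      ultimately show "R (g t) (h t)"
        unfolding R_def using g0
        by (intro exI[of _ "g0 +++ ?g"] exI[of _ "h0 +++ ?h"]) (auto simp: path_image_join)
    qed
    then show ?thesis
      using h(1) unfolding path_def by (subst continuous_on_cong[OF refl, of _ _ h]) auto
  qed
  then show thesis using kC that by blast
qed


section \<open>The spinor of a spin frame\<close>

text \<open>The lift \<open>\<kappa>\<close> of the flag map stands for the identification of the bundle of spin frames with
  \<open>SL(2, \<complex>)\<close>, of whose matrices it is one column. Its sign tells the two lifts of a frame apart.\<close>

locale spin_frame_spinor =
  fixes FrS :: "'s::topological_space set" and pr :: "'s \<Rightarrow> frame" and \<kappa> :: "'s \<Rightarrow> spinor"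
  assumes spin_bundle: "spin_frame_bundle FrS pr"
    and spinor_nonzero: "s \<in> FrS \<Longrightarrow> \<kappa> s \<noteq> 0"
    and spinor_square_eq_flag: "s \<in> FrS \<Longrightarrow> spinor_square (\<kappa> s) = flag (pr s)"
    and spinor_path: "path g \<Longrightarrow> path_image g \<subseteq> FrS \<Longrightarrow> path (\<kappa> \<circ> g)"

lemma spin_frame_spinor_exists:
  assumes b: "spin_frame_bundle FrS pr"
  obtains \<kappa> where "spin_frame_spinor FrS pr \<kappa>"
proof -
  have cov: "covering_space FrS pr frames" and sc: "simply_connected FrS"
    using b by (auto simp: spin_frame_bundle_def)
  have "continuous_on FrS (\<lambda>s. flag (pr s))"
    unfolding flag_def self_dual_def Let_def
    by (intro continuous_intros covering_space_imp_continuous[OF cov])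
  moreover have "(\<lambda>s. flag (pr s)) \<in> FrS \<rightarrow> null_cone"
    using covering_space_imp_surjective[OF cov] by (auto intro!: flag_in_null_cone)
  ultimately obtain \<kappa> where "\<And>s. s \<in> FrS \<Longrightarrow> \<kappa> s \<in> - {0} \<and> spinor_square (\<kappa> s) = flag (pr s)"
    "\<And>g. path g \<Longrightarrow> path_image g \<subseteq> FrS \<Longrightarrow> path (\<kappa> \<circ> g)"
    using covering_space_lift_along_paths[OF covering_space_spinor_square sc] by blast
  then have "spin_frame_spinor FrS pr \<kappa>"
    using b by unfold_locales auto
  then show thesis by (rule that)
qed

context spin_frame_spinor
begin

lemma pr_in_frames: "s \<in> FrS \<Longrightarrow> pr s \<in> frames"
  using spin_bundle covering_space_imp_surjective unfolding spin_frame_bundle_def by blast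

text \<open>Along a path the spinor is determined by its initial value and by the flags of the frames, because
  \<open>spinor_square\<close> is a covering. Every computation with spin frames goes through this lemma: it is
  enough to exhibit a continuous family of spinors with the right squares.\<close>

lemma spinor_along_path:
  assumes g: "path g" "path_image g \<subseteq> FrS"
    and k: "continuous_on {0..1} k" "k 0 = \<kappa> (g 0)"
    and sq: "\<And>r. r \<in> {0..1} \<Longrightarrow> spinor_square (k r) = flag (pr (g r))"
  shows "\<kappa> (g 1) = k 1"
proof -
  have gF: "g r \<in> FrS" if "r \<in> {0..1}" for r
    using g(2) that by (auto simp: path_image_def)
  have nc: "flag (pr (g r)) \<in> null_cone" if "r \<in> {0..1}" for r
    by (intro flag_in_null_cone pr_in_frames gF that)
  have nz: "k r \<noteq> 0" if "r \<in> {0..1}" for r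
  proof
    assume "k r = 0"
    then have "spinor_square (k r) = 0" by (simp add: spinor_square_def zero_prod_def)
    then show False using nc[OF that] sq[OF that] by (simp add: null_cone_def)
  qed
  have "(\<kappa> \<circ> g) 1 = k 1"
  proof (rule covering_space_lift_unique[OF covering_space_spinor_square, where f = "\<lambda>r. spinor_square (k r)" and T = "{0..1}" and a = 0])
    show "continuous_on {0..1} (\<lambda>r. spinor_square (k r))"
      unfolding spinor_square_def by (intro continuous_intros k)
    show "continuous_on {0..1} (\<kappa> \<circ> g)" using spinor_path[OF g] by (simp add: path_def)
  qed (use k sq nc nz gF spinor_nonzero spinor_square_eq_flag in auto)
  then show ?thesis by simp
qed

lemma spinor_move:
  assumes m: "spin_move FrS pr m t s s'"
    and k: "continuous_on UNIV k" "k 0 = \<kappa> s" "\<And>t. spinor_square (k t) = flag (m t (pr s))"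
  shows "\<kappa> s' = k t"
proof -
  obtain g where g: "path g" "path_image g \<subseteq> FrS" "pathstart g = s" "pathfinish g = s'"
    "\<forall>r\<in>{0..1}. pr (g r) = m (r * t) (pr s)"
    using m unfolding spin_move_def by blast
  have "\<kappa> (g 1) = k (1 * t)"
    by (rule spinor_along_path[OF g(1,2), where k = "\<lambda>r. k (r * t)"])
       (use g(3,5) k(2,3) in \<open>auto simp: pathstart_def intro!: continuous_on_compose2[OF k(1)] continuous_intros\<close>)
  then show ?thesis using g(4) by (simp add: pathfinish_def)
qed

lemma spin_move_in: "spin_move FrS pr m t s s' \<Longrightarrow> s \<in> FrS \<and> s' \<in> FrS \<and> pr s' = m t (pr s)"
  unfolding spin_move_def
  by (metis atLeastAtMost_iff mult_1 order_refl pathfinish_def pathfinish_in_path_image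
      pathstart_in_path_image subsetD zero_le_one)

lemma spinor_translate:
  assumes m: "spin_move FrS pr translate_frame t s s'"
  shows "\<kappa> s' = spinor_scale (exp (of_real t / 2)) (\<kappa> s)"
proof (rule spinor_move[OF m, where k = "\<lambda>t. spinor_scale (exp (of_real t / 2)) (\<kappa> s)"])
  have s: "s \<in> FrS" using spin_move_in[OF m] by simp
  obtain x a b c where f: "pr s = (x, a, b, c)" by (cases "pr s")
  show "spinor_square (spinor_scale (exp (of_real t / 2)) (\<kappa> s)) = flag (translate_frame t (pr s))" for t
  proof -
    have "geodesic x a t + (sinh t *\<^sub>R x + cosh t *\<^sub>R a) = exp t *\<^sub>R (x + a)"
      by (simp add: geodesic_def vec_eq_iff cosh_plus_sinh[symmetric] algebra_simps)
    moreover have "(exp (of_real t / 2 :: complex))\<^sup>2 = of_real (exp t)"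
      by (simp add: exp_double[symmetric] exp_of_real)
    ultimately show ?thesis
      by (simp add: spinor_square_scale spinor_square_eq_flag[OF s] flag_def f self_dual_linear(5) sym2_scale_of_real)
  qed
  show "continuous_on UNIV (\<lambda>t. spinor_scale (exp (of_real t / 2)) (\<kappa> s))"
    unfolding spinor_scale_def by (intro continuous_intros) auto
qed (simp add: spinor_scale_def)

lemma spinor_rotate_first:
  assumes m: "spin_move FrS pr (rotate_frame first_vec) t s s'"
  shows "\<kappa> s' = spinor_scale (exp (\<i> * of_real t / 2)) (\<kappa> s)"
proof (rule spinor_move[OF m, where k = "\<lambda>t. spinor_scale (exp (\<i> * of_real t / 2)) (\<kappa> s)"])
  have s: "s \<in> FrS" using spin_move_in[OF m] by simp
  obtain x a b c where f: "pr s = (x, a, b, c)" by (cases "pr s")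
  then have fr: "(x, a, b, c) \<in> frames" using pr_in_frames[OF s] by simp
  show "spinor_square (spinor_scale (exp (\<i> * of_real t / 2)) (\<kappa> s))
      = flag (rotate_frame first_vec t (pr s))" for t
  proof -
    have "(exp (\<i> * of_real t / 2))\<^sup>2 = of_real (cos t) + \<i> * of_real (sin t)"
      by (simp add: exp_double[symmetric] exp_Euler[of "of_real t"] cos_of_real sin_of_real)
    then show ?thesis
      unfolding f rotate_frame_in_frames(1)[OF fr]
      by (simp add: spinor_square_scale spinor_square_eq_flag[OF s] f flag_def self_dual_linear(2,6) frame_flag_third[OF fr]
          sym2_scale_complex)
  qed
  show "continuous_on UNIV (\<lambda>t. spinor_scale (exp (\<i> * of_real t / 2)) (\<kappa> s))"
    unfolding spinor_scale_def by (intro continuous_intros) auto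
qed (simp add: spinor_scale_def)

text \<open>This rotation takes the inward spin frame at a point of a horosphere to the outward one. As the
  determinant is the same constant everywhere, no sign ambiguity is left in lambda lengths.\<close>

lemma spinor_det_rotate_second:
  assumes m: "spin_move FrS pr (rotate_frame second_vec) (- pi) s s'"
  shows "spinor_det (\<kappa> s') (\<kappa> s) = - 2 * \<i>"
proof -
  have s: "s \<in> FrS" using spin_move_in[OF m] by simp
  obtain x a b c where f: "pr s = (x, a, b, c)" by (cases "pr s")
  then have fr: "(x, a, b, c) \<in> frames" using pr_in_frames[OF s] by simp
  have sq: "spinor_square (\<kappa> s) = self_dual (x + a) b"
    using spinor_square_eq_flag[OF s] by (simp add: f flag_def)
  let ?e = "sl2_act (self_dual a c) (\<kappa> s)"
  have "\<kappa> s' = cos (- pi / 2) *\<^sub>R \<kappa> s + sin (- pi / 2) *\<^sub>R ?e"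
  proof (rule spinor_move[OF m, where k = "\<lambda>t. cos (t / 2) *\<^sub>R \<kappa> s + sin (t / 2) *\<^sub>R ?e"])
    show "continuous_on UNIV (\<lambda>t. cos (t / 2) *\<^sub>R \<kappa> s + sin (t / 2) *\<^sub>R ?e)"
      by (intro continuous_intros) auto
    show "spinor_square (cos (t / 2) *\<^sub>R \<kappa> s + sin (t / 2) *\<^sub>R ?e)
        = flag (rotate_frame second_vec t (pr s))" for t
      unfolding frame_spinor_rotate[OF fr sq] f
      using frameD[OF fr]
      by (simp add: flag_def Let_def rotate_vec_def frame_hcross_swap[OF fr] hcross_linear algebra_simps)
  qed simp
  then have "\<kappa> s' = - ?e" by simp
  then have "spinor_det (\<kappa> s') (\<kappa> s) = spinor_det (\<kappa> s) ?e"
    by (simp add: spinor_det_def)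
  then show ?thesis using frame_spinor_det[OF fr sq] by simp
qed

lemma spinor_complex_distance:
  assumes "complex_distance FrS pr \<gamma> s s' d"
  shows "\<kappa> s' = spinor_scale (exp (d / 2)) (\<kappa> s)"
proof -
  obtain m where m: "spin_move FrS pr translate_frame (Re d) s m"
    "spin_move FrS pr (rotate_frame first_vec) (Im d) m s'"
    using assms unfolding complex_distance_def by blast
  have "exp (\<i> * of_real (Im d) / 2) * exp (of_real (Re d) / 2) = exp (d / 2)"
    by (simp add: exp_add[symmetric] complex_eq_iff add_divide_distrib[symmetric] complex_eq[symmetric] algebra_simps)
  then show ?thesis
    unfolding spinor_rotate_first[OF m(2)] spinor_translate[OF m(1)]
    by (simp add: spinor_scale_def mult.assoc[symmetric])
qed

end


section \<open>Points at infinity and horospheres\<close>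

lemma ideal_boundaryD:
  assumes "z \<in> ideal_boundary" "n \<in> z"
  shows "mink n n = 0" "n $ 1 > 0" "z = {c *\<^sub>R n |c. c > 0}"
proof -
  obtain m where m: "z = {c *\<^sub>R m |c. c > 0}" "mink m m = 0" "m $ 1 > 0"
    using assms(1) unfolding ideal_boundary_def by auto
  then obtain c where c: "c > 0" "n = c *\<^sub>R m" using assms(2) by auto
  show "mink n n = 0" "n $ 1 > 0" using c m by auto
  show "z = {c *\<^sub>R n |c. c > 0}"
  proof (intro set_eqI iffI)
    fix w assume "w \<in> z"
    then obtain e where "e > 0" "w = e *\<^sub>R m" using m by auto
    then have "w = (e / c) *\<^sub>R n \<and> e / c > 0" using c by simp
    then show "w \<in> {c *\<^sub>R n |c. c > 0}" by blast
  next
    fix w assume "w \<in> {c *\<^sub>R n |c. c > 0}"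
    then obtain e where "e > 0" "w = (e * c) *\<^sub>R m" using c by auto
    then show "w \<in> z" using c m by auto
  qed
qed

lemma ideal_boundary_eqI:
  assumes "z \<in> ideal_boundary" "z' \<in> ideal_boundary" "n \<in> z" "n \<in> z'"
  shows "z = z'"
  using ideal_boundaryD(3)[OF assms(1,3)] ideal_boundaryD(3)[OF assms(2,4)] by simp

lemma ideal_boundary_scale: "z \<in> ideal_boundary \<Longrightarrow> n \<in> z \<Longrightarrow> c > 0 \<Longrightarrow> c *\<^sub>R n \<in> z"
  using ideal_boundaryD(3) by blast

lemma ideal_boundary_nonempty: "z \<in> ideal_boundary \<Longrightarrow> \<exists>n. n \<in> z"
  unfolding ideal_boundary_def by (auto intro: exI[of _ 1])

text \<open>Up to the factor \<open>exp s / 2\<close>, which the projection to \<open>x $ 1 = 1\<close> cancels, the geodesic is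
  \<open>(x + u) + exp (- 2 s) (x - u)\<close>.\<close>

lemma geodesic_limit:
  assumes "(x + u) $ 1 \<noteq> 0"
  shows "((\<lambda>s. (1 / (geodesic x u s $ 1)) *\<^sub>R geodesic x u s) \<longlongrightarrow> (1 / (x + u) $ 1) *\<^sub>R (x + u)) at_top"
proof -
  have e: "(1 / (geodesic x u s $ 1)) *\<^sub>R geodesic x u s
      = (1 / (((x + u) + exp (- 2 * s) *\<^sub>R (x - u)) $ 1)) *\<^sub>R ((x + u) + exp (- 2 * s) *\<^sub>R (x - u))" for s
  proof -
    have "geodesic x u s = (exp s / 2) *\<^sub>R ((x + u) + exp (- 2 * s) *\<^sub>R (x - u))"
    proof -
      have "exp s * exp (- 2 * s) = exp (- s)" by (simp add: mult_exp_exp)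
      then show ?thesis
        by (simp add: geodesic_def cosh_def sinh_def algebra_simps add_divide_distrib diff_divide_distrib)
    qed
    moreover have "(1 / ((p *\<^sub>R w) $ 1)) *\<^sub>R (p *\<^sub>R w) = (1 / w $ 1) *\<^sub>R w" if "p \<noteq> 0" for p and w :: "real ^ 4"
      using that by simp
    ultimately show ?thesis by (metis exp_not_eq_zero divide_eq_0_iff zero_neq_numeral)
  qed
  have "((\<lambda>s::real. exp (- 2 * s)) \<longlongrightarrow> 0) at_top"
    by (rule filterlim_compose[OF exp_at_bot])
       (rule filterlim_tendsto_neg_mult_at_bot[OF tendsto_const _ filterlim_ident], simp)
  then have "((\<lambda>s. (1 / (((x + u) + exp (- 2 * s) *\<^sub>R (x - u)) $ 1)) *\<^sub>R ((x + u) + exp (- 2 * s) *\<^sub>R (x - u)))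
    \<longlongrightarrow> (1 / (((x + u) + 0 *\<^sub>R (x - u)) $ 1)) *\<^sub>R ((x + u) + 0 *\<^sub>R (x - u))) at_top"
    by (intro tendsto_intros) (use assms in auto)
  then show ?thesis unfolding e by simp
qed

text \<open>The geodesic with velocity \<open>N\<close> tends to the ray of \<open>x + N\<close>, so \<open>x + N\<close> is a multiple of \<open>n\<close>, and the
  product with \<open>x\<close> fixes the multiple. Thus the null vector in the flag of an outward frame is \<open>n\<close>, the
  same at all points of the horosphere.\<close>

lemma normal_out_eq:
  assumes z: "z \<in> ideal_boundary" "n \<in> z" and x: "x \<in> hyp3" "mink x n = - 1"
  shows "normal_out z x = n - x"
  unfolding normal_out_def
proof (rule the_equality)
  note n = ideal_boundaryD[OF z]
  have xx: "mink x x = - 1" using x by (simp add: hyp3_def)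
  show "unit_tangent x (n - x) \<and> (\<forall>u\<in>horo_tangent z x. mink (n - x) u = 0) \<and>
     tends_to_ideal (geodesic x (n - x)) z at_top"
  proof (intro conjI ballI)
    show "unit_tangent x (n - x)"
      using n xx x by (simp add: unit_tangent_def mink_commute[of n x])
    show "mink (n - x) u = 0" if "u \<in> horo_tangent z x" for u
      using that z by (simp add: horo_tangent_def)
    show "tends_to_ideal (geodesic x (n - x)) z at_top"
      unfolding tends_to_ideal_def
      using geodesic_limit[of x "n - x"] n ideal_boundary_scale[OF z, of "1 / n $ 1"]
      by (intro bexI[of _ "(1 / n $ 1) *\<^sub>R n"]) auto
  qed
  fix N assume N: "unit_tangent x N \<and> (\<forall>u\<in>horo_tangent z x. mink N u = 0) \<and>
     tends_to_ideal (geodesic x N) z at_top"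
  then have m: "mink x N = 0" "mink N N = 1" by (auto simp: unit_tangent_def)
  obtain l where l: "l \<in> z"
    "((\<lambda>s. (1 / (geodesic x N s $ 1)) *\<^sub>R geodesic x N s) \<longlongrightarrow> l) at_top"
    using N by (auto simp: tends_to_ideal_def)
  have nz: "(x + N) $ 1 \<noteq> 0"
  proof
    assume "(x + N) $ 1 = 0"
    then have "x + N = 0"
      using m xx by (intro mink_spatial_eq_0) (auto simp: mink_commute[of N x])
    then have "mink x (x + N) = 0" by simp
    then show False using m xx by simp
  qed
  have "l = (1 / (x + N) $ 1) *\<^sub>R (x + N)"
    using l(2) geodesic_limit[OF nz] by (rule tendsto_unique[rotated]) simp
  then have "x + N = (x + N) $ 1 *\<^sub>R l" using nz by simp
  moreover obtain c where "l = c *\<^sub>R n" using l(1) n(3) by blast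
  ultimately obtain c where c: "x + N = c *\<^sub>R n" by (metis scaleR_scaleR)
  have "mink x (x + N) = - 1" using m xx by simp
  then have "c = 1" using c x by simp
  then show "N = n - x" using c by (metis add_diff_cancel_left' scaleR_one)
qed

lemma horosphereD:
  assumes "horosphere z H"
  obtains n where "z \<in> ideal_boundary" "n \<in> z" "mink n n = 0" "n $ 1 > 0" "H = {x \<in> hyp3. mink x n = - 1}"
proof -
  from assms obtain n where z: "z \<in> ideal_boundary" "n \<in> z" and H: "H = {x \<in> hyp3. mink x n = - 1}"
    unfolding horosphere_def by blast
  show thesis by (rule that[OF z ideal_boundaryD(1,2)[OF z] H])
qed

lemma hyp3I_horosphere:
  assumes "mink n n = 0" "n $ 1 > 0" "mink x x = - 1" "mink x n = - 1"
  shows "x \<in> hyp3"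
  using assms future_if_mink_neg[of n x] by (simp add: hyp3_def mink_commute)


section \<open>Null rotations\<close>

text \<open>For \<open>w\<close> orthogonal to \<open>n\<close> this is the exponential of the bivector \<open>n \<and> w\<close>, up to sign. If \<open>w\<close> is
  spacelike, it is a parabolic isometry that fixes \<open>n\<close>; on the horospheres of \<open>n\<close> these maps act as
  translations.\<close>

definition null_rotation :: "real ^ 4 \<Rightarrow> real ^ 4 \<Rightarrow> real ^ 4 \<Rightarrow> real ^ 4" where
  "null_rotation n w y = y + mink y n *\<^sub>R w - (mink y w + mink w w * mink y n / 2) *\<^sub>R n"

lemma linear_null_rotation: "linear (null_rotation n w)"
  by (rule linearI) (simp_all add: null_rotation_def algebra_simps add_divide_distrib)

lemma null_rotation_compose:
  assumes "mink n n = 0" "mink w n = 0" "mink w' n = 0"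
  shows "null_rotation n w (null_rotation n w' y) = null_rotation n (w + w') y"
proof -
  have "mink n w = 0" "mink n w' = 0" "mink w' w = mink w w'" using assms by (simp_all add: mink_commute)
  then have "mink (null_rotation n w' y) n = mink y n"
    "mink (null_rotation n w' y) w = mink y w + mink y n * mink w w'"
    "mink (w + w') (w + w') = mink w w + 2 * mink w w' + mink w' w'"
    using assms by (simp_all add: null_rotation_def)
  then show ?thesis
    unfolding null_rotation_def[of n w] null_rotation_def[of n "w + w'"]
    by (simp add: null_rotation_def vec_eq_iff field_simps)
qed

lemma null_rotation_zero: "null_rotation n 0 y = y"
  by (simp add: null_rotation_def)

lemma mink_null_rotation:
  assumes "mink n n = 0" "mink w n = 0"
  shows "mink (null_rotation n w x) (null_rotation n w y) = mink x y"
proof -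
  have "mink n w = 0" "mink n y = mink y n" "mink w y = mink y w" using assms by (simp_all add: mink_commute)
  with assms show ?thesis
    by (simp add: null_rotation_def field_simps)
qed

lemma det_isometry:
  assumes "\<And>x y. mink (A *v x) (A *v y) = mink x y"
  shows "(det A)\<^sup>2 = 1"
proof -
  have "x \<bullet> (transpose A ** gram ** A *v y) = x \<bullet> (gram *v y)" for x y
    using assms[of x y] unfolding mink_gram
    by (simp add: matrix_vector_mul_assoc[symmetric] transpose_matrix_vector
        inner_commute[of x "_ v* A"] dot_lmul_matrix inner_commute[of _ "A *v x"])
  then have "transpose A ** gram ** A = gram"
    by (metis matrix_eq vector_eq_ldot)
  then have "det A * det gram * det A = det gram"
    by (metis det_mul det_transpose)
  then show ?thesis by (simp add: det_gram power2_eq_square)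
qed

text \<open>A fixed vector must be orthogonal to \<open>n\<close>, since otherwise \<open>w\<close> would be proportional to \<open>n\<close>; no
  point of the hyperboloid and no other null ray is orthogonal to \<open>n\<close>.\<close>

lemma null_rotation_parabolic:
  assumes z: "z \<in> ideal_boundary" "n \<in> z" and w: "mink w n = 0" "mink w w \<noteq> 0"
  shows "parabolic (matrix (null_rotation n w))"
proof -
  note n = ideal_boundaryD[OF z]
  have app: "matrix (null_rotation n w) *v y = null_rotation n w y" for w y
    by (simp add: matrix_works linear_null_rotation)
  have iso: "mink (matrix (null_rotation n w) *v x) (matrix (null_rotation n w) *v y) = mink x y"
    if "mink w n = 0" for x y w
    unfolding app using mink_null_rotation[OF n(1) that] .
  have fix_n: "null_rotation n w n = n"
    using n(1) w(1) by (simp add: null_rotation_def mink_commute)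
  have pres_n: "mink (null_rotation n w y) n = mink y n" for y
    using mink_null_rotation[OF n(1) w(1), of y n] fix_n by simp
  have no_fix: "mink y n = 0" if "null_rotation n w y = y" for y
  proof (rule ccontr)
    assume "mink y n \<noteq> 0"
    have "mink y n *\<^sub>R w = (mink y w + mink w w * mink y n / 2) *\<^sub>R n"
      using that by (simp add: null_rotation_def)
    then have "mink (mink y n *\<^sub>R w) w = mink ((mink y w + mink w w * mink y n / 2) *\<^sub>R n) w" by simp
    then show False using w \<open>mink y n \<noteq> 0\<close> by (simp add: mink_commute[of n w])
  qed
  have neg: "mink x n < 0" if "x \<in> hyp3" for x
    using mink_neg_if_future[of x n] n that by (simp add: hyp3_def)
  have "orient_isometry (matrix (null_rotation n w))"
    unfolding orient_isometry_def
  proof (intro conjI allI ballI)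
    show "mink (matrix (null_rotation n w) *v x) (matrix (null_rotation n w) *v y) = mink x y" for x y
      by (rule iso[OF w(1)])
    show "matrix (null_rotation n w) *v x \<in> hyp3" if "x \<in> hyp3" for x
    proof -
      have "mink (null_rotation n w x) (null_rotation n w x) = - 1"
        using mink_null_rotation[OF n(1) w(1)] that by (simp add: hyp3_def)
      moreover have "mink n (null_rotation n w x) < 0"
        using neg[OF that] pres_n[of x] by (simp add: mink_commute)
      ultimately show ?thesis
        unfolding app using future_if_mink_neg[of n "null_rotation n w x"] n by (simp add: hyp3_def)
    qed
    \<comment> \<open>the determinant is the square of \<open>\<plusminus>1\<close>, because a null rotation is the square of the one with
        half the parameter\<close>
    let ?h = "(1 / 2) *\<^sub>R w"
    have "null_rotation n w = null_rotation n ?h \<circ> null_rotation n ?h"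
    proof
      fix y
      have "?h + ?h = w" by (simp add: scaleR_add_left[symmetric])
      then show "null_rotation n w y = (null_rotation n ?h \<circ> null_rotation n ?h) y"
        using null_rotation_compose[OF n(1), of ?h ?h y] w(1) by simp
    qed
    then have "det (matrix (null_rotation n w)) = (det (matrix (null_rotation n ?h)))\<^sup>2"
      by (simp add: matrix_compose linear_null_rotation det_mul power2_eq_square)
    also have "\<dots> = 1" using w(1) by (intro det_isometry iso) simp
    finally show "det (matrix (null_rotation n w)) = 1" .
  qed
  moreover have "matrix (null_rotation n w) *v x \<noteq> x" if "x \<in> hyp3" for x
    using no_fix[of x] neg[OF that] unfolding app by auto
  moreover have "\<exists>!z. z \<in> ideal_boundary \<and> (*v) (matrix (null_rotation n w)) ` z = z"
  proof (rule ex1I)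
    have "null_rotation n w (c *\<^sub>R n) = c *\<^sub>R n" for c
      using fix_n linear_cmul[OF linear_null_rotation] by metis
    then have "(*v) (matrix (null_rotation n w)) ` z = z"
      unfolding app n(3) by (force simp: image_iff)
    then show "z \<in> ideal_boundary \<and> (*v) (matrix (null_rotation n w)) ` z = z" using z by simp
    fix z' assume z': "z' \<in> ideal_boundary \<and> (*v) (matrix (null_rotation n w)) ` z' = z'"
    then obtain m where m: "m \<in> z'" using ideal_boundary_nonempty by blast
    note M = ideal_boundaryD[OF conjunct1[OF z'] m]
    have "null_rotation n w m \<in> z'" using z' m unfolding app by blast
    then obtain c where c: "null_rotation n w m = c *\<^sub>R m" using M(3) by blast
    have "mink m n = 0"
    proof (rule ccontr)
      assume nz: "mink m n \<noteq> 0"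
      then have "c = 1" using pres_n[of m] c by simp
      then show False using no_fix[of m] c nz by simp
    qed
    then have "m = (m $ 1 / n $ 1) *\<^sub>R n"
      using M n by (intro null_orthogonal_parallel) (simp_all add: mink_commute)
    then have "m \<in> z" using ideal_boundary_scale[OF z, of "m $ 1 / n $ 1"] M n by simp
    then show "z' = z" using ideal_boundary_eqI z z' m by blast
  qed
  ultimately show ?thesis unfolding parabolic_def by blast
qed

lemma null_rotation_moves:
  assumes "mink x x = - 1" "mink y y = - 1" "mink x n = - 1" "mink y n = - 1"
  shows "null_rotation n (x - y) x = y"
proof -
  have "mink x (x - y) = mink (x - y) (x - y) / 2"
    using assms by (simp add: mink_commute[of y x])
  then show ?thesis
    using assms(3) by (simp add: null_rotation_def del: mink_bilinear)
qed

lemma null_rotation_horosphere: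
  assumes n: "mink n n = 0" "n $ 1 > 0" and H: "H = {x \<in> hyp3. mink x n = - 1}" and w: "mink w n = 0"
  shows "null_rotation n w ` H = H"
proof -
  have sub: "null_rotation n w x \<in> H" if "x \<in> H" "mink w n = 0" for w x
  proof -
    have "null_rotation n w n = n"
      using n(1) that by (simp add: null_rotation_def mink_commute)
    then have "mink (null_rotation n w x) n = mink x n"
      using mink_null_rotation[OF n(1) that(2), of x n] by simp
    moreover have "mink (null_rotation n w x) (null_rotation n w x) = - 1"
      using that mink_null_rotation[OF n(1) that(2)] by (simp add: H hyp3_def)
    ultimately show ?thesis
      using that n hyp3I_horosphere by (simp add: H)
  qed
  have "x \<in> null_rotation n w ` H" if "x \<in> H" for x
  proof
    show "x = null_rotation n w (null_rotation n (- w) x)"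
      using null_rotation_compose[of n w "- w" x] n w by (simp add: null_rotation_zero)
    show "null_rotation n (- w) x \<in> H" using sub that w by simp
  qed
  then show ?thesis using sub w by auto
qed

text \<open>The null rotation that carries \<open>x\<close> to \<open>y\<close> changes \<open>v x\<close>, which is orthogonal to \<open>n\<close>, by a multiple of
  \<open>n\<close> only. So a parallel field on a horosphere is one and the same flag, seen from all its points.\<close>

lemma decoration_flag_constant:
  assumes dec: "decoration z H v" and z: "z \<in> ideal_boundary" "n \<in> z"
    and H: "H = {x \<in> hyp3. mink x n = - 1}" and xy: "x \<in> H" "y \<in> H"
  shows "self_dual n (v y) = self_dual n (v x)"
proof (cases "x = y")
  case False
  note n = ideal_boundaryD[OF z]
  have m: "mink x x = - 1" "mink y y = - 1" "mink x n = - 1" "mink y n = - 1"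
    using xy by (auto simp: H hyp3_def)
  let ?w = "x - y"
  have w: "mink ?w n = 0" using m by simp
  have w2: "mink ?w ?w \<noteq> 0"
  proof
    assume "mink ?w ?w = 0"
    then have xy1: "mink x y = - 1" using m by (simp add: mink_commute[of y x])
    have "mink (x $ 1 *\<^sub>R y - y $ 1 *\<^sub>R x) (x $ 1 *\<^sub>R y - y $ 1 *\<^sub>R x) = - (x $ 1 - y $ 1)\<^sup>2"
      unfolding mink_time_combination using m xy1 by (simp add: power2_eq_square algebra_simps)
    then have e: "x $ 1 *\<^sub>R y - y $ 1 *\<^sub>R x = 0" 
      by (intro mink_spatial_eq_0) (simp_all del: mink_bilinear)
    then have "(x $ 1 - y $ 1)\<^sup>2 = 0"
      using \<open>mink _ _ = - (x $ 1 - y $ 1)\<^sup>2\<close> by simp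
    then have "x $ 1 *\<^sub>R (y - x) = 0" using e by (simp add: algebra_simps)
    moreover have "x $ 1 > 0" using xy by (simp add: H hyp3_def)
    ultimately show False using False by simp
  qed
  let ?A = "matrix (null_rotation n ?w)"
  have app: "?A *v y = null_rotation n ?w y" for y
    by (simp add: matrix_works linear_null_rotation)
  have "(*v) ?A ` H = H"
    unfolding app using null_rotation_horosphere[OF n(1,2) H w] .
  then have "?A *v v x = v (?A *v x)"
    using dec null_rotation_parabolic[OF z w w2] xy unfolding decoration_def by blast
  then have "v y = null_rotation n ?w (v x)"
    unfolding app using null_rotation_moves[OF m] by simp
  moreover have "mink (v x) n = 0"
    using dec z xy unfolding decoration_def horo_tangent_def by (auto simp: mink_commute)
  ultimately show ?thesis
    by (simp add: null_rotation_def self_dual_linear)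
qed simp

lemma horosphere_path:
  assumes n: "mink n n = 0" "n $ 1 > 0" and H: "H = {x \<in> hyp3. mink x n = - 1}" and xy: "x \<in> H" "y \<in> H"
  obtains g where "path g" "path_image g \<subseteq> H" "pathstart g = x" "pathfinish g = y"
proof
  have m: "mink x x = - 1" "mink y y = - 1" "mink x n = - 1" "mink y n = - 1"
    using xy by (auto simp: H hyp3_def)
  let ?g = "\<lambda>r. null_rotation n (r *\<^sub>R (x - y)) x"
  show "path ?g"
    unfolding path_def null_rotation_def mink_bilinear by (intro continuous_intros) auto
  have "?g r \<in> H" for r
    using null_rotation_horosphere[OF n H, of "r *\<^sub>R (x - y)"] m xy by auto
  then show "path_image ?g \<subseteq> H" by (auto simp: path_image_def)
  show "pathstart ?g = x" by (simp add: pathstart_def null_rotation_zero)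
  show "pathfinish ?g = y" using null_rotation_moves[OF m] by (simp add: pathfinish_def)
qed


section \<open>Joining adapted spin frames\<close>

lemma frame_rotation_exists:
  assumes f: "(x, a, b, c) \<in> frames" and f': "(x, a, b', c') \<in> frames"
  obtains \<theta> where "rotate_frame first_vec \<theta> (x, a, b, c) = (x, a, b', c')"
proof -
  note D = frameD[OF f] and D' = frameD[OF f']
  define p q where "p = mink b b'" and "q = mink c b'"
  have "b' - (p *\<^sub>R b + q *\<^sub>R c) = 0"
    by (rule frame_basis[OF f]) (simp_all add: D D' p_def q_def)
  then have b': "b' = p *\<^sub>R b + q *\<^sub>R c" by simp
  have "p\<^sup>2 + q\<^sup>2 = 1"
    using D'(4) unfolding b' by (simp add: D power2_eq_square)
  then obtain \<theta> where \<theta>: "p = cos \<theta>" "q = sin \<theta>"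
    by (metis sincos_total_2pi)
  have "c' = hcross x a b'" by (rule frame_hcross[OF f', symmetric])
  also have "\<dots> = p *\<^sub>R c - q *\<^sub>R b"
    unfolding b' by (simp add: hcross_linear frame_hcross[OF f] frame_hcross_swap[OF f])
  finally show thesis
    by (intro that[of \<theta>]) (simp add: rotate_frame_in_frames(1)[OF f] b' \<theta> del: rotate_frame.simps)
qed

context spin_frame_spinor
begin

lemma spin_move_exists:
  assumes s: "s \<in> FrS" and m: "continuous_on UNIV (\<lambda>t. m t (pr s))" "\<And>t. m t (pr s) \<in> frames"
    "m 0 (pr s) = pr s"
  obtains s' where "spin_move FrS pr m t s s'"
proof -
  have cov: "covering_space FrS pr frames" using spin_bundle by (simp add: spin_frame_bundle_def)
  have "continuous_on {0..1} (\<lambda>r. m (r * t) (pr s))"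
    by (rule continuous_on_compose2[OF m(1)]) (auto intro!: continuous_intros)
  then obtain h where h: "continuous_on {0..1} h" "h \<in> {0..1} \<rightarrow> FrS" "h 0 = s"
    "\<And>r. r \<in> {0..1} \<Longrightarrow> pr (h r) = m (r * t) (pr s)"
    using covering_space_path_lift[OF cov, of "\<lambda>r. m (r * t) (pr s)" s] s m by auto
  then have "spin_move FrS pr m t s (h 1)"
    unfolding spin_move_def
    by (intro exI[of _ h]) (auto simp: path_def path_image_def pathstart_def pathfinish_def)
  then show thesis by (rule that)
qed

lemma spin_translate_exists:
  assumes s: "s \<in> FrS"
  obtains s' where "spin_move FrS pr translate_frame t s s'"
proof (rule spin_move_exists[OF s, of translate_frame])
  obtain x a b c where f: "pr s = (x, a, b, c)" by (cases "pr s")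
  show "continuous_on UNIV (\<lambda>t. translate_frame t (pr s))"
    unfolding f translate_frame.simps geodesic_def cosh_def sinh_def by (intro continuous_intros) auto
  show "translate_frame t (pr s) \<in> frames" for t
    using translate_frame_in_frames pr_in_frames[OF s] unfolding f by blast
  show "translate_frame 0 (pr s) = pr s" by (simp add: f geodesic_def)
qed

lemma spin_rotate_exists:
  assumes s: "s \<in> FrS"
  obtains s' where "spin_move FrS pr (rotate_frame first_vec) t s s'"
proof (rule spin_move_exists[OF s, of "rotate_frame first_vec"])
  obtain x a b c where f: "pr s = (x, a, b, c)" by (cases "pr s")
  have fr: "(x, a, b, c) \<in> frames" using pr_in_frames[OF s] f by simp
  note rot = rotate_frame_in_frames[OF fr]
  show "continuous_on UNIV (\<lambda>t. rotate_frame first_vec t (pr s))"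
    unfolding f rot(1) by (intro continuous_intros)
  show "rotate_frame first_vec t (pr s) \<in> frames" for t
    using rot(2) unfolding f .
  show "rotate_frame first_vec 0 (pr s) = pr s" unfolding f rot(1) by simp
qed

text \<open>The frames determine the angle of rotation modulo \<open>2 \<pi>\<close> only. Adding \<open>2 \<pi>\<close> changes the sign of the
  spinor and thus leads to the other point of the fibre, so one of the two angles is right.\<close>

lemma spin_frames_join:
  assumes s: "s \<in> FrS" "s' \<in> FrS"
    and eq: "fst (pr s') = fst (translate_frame \<rho> (pr s))"
      "first_vec (pr s') = first_vec (translate_frame \<rho> (pr s))"
  obtains m \<theta> where "spin_move FrS pr translate_frame \<rho> s m"
    "spin_move FrS pr (rotate_frame first_vec) \<theta> m s'"
proof -
  obtain m where m: "spin_move FrS pr translate_frame \<rho> s m"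
    using spin_translate_exists[OF s(1)] by blast
  then have mF: "m \<in> FrS" and prm: "pr m = translate_frame \<rho> (pr s)" using spin_move_in by auto
  obtain x a b c where f: "pr m = (x, a, b, c)" by (cases "pr m")
  then obtain b' c' where f': "pr s' = (x, a, b', c')"
    using eq by (cases "pr s'") (auto simp: prm[symmetric])
  have fr: "(x, a, b, c) \<in> frames" "(x, a, b', c') \<in> frames"
    using pr_in_frames[OF mF] pr_in_frames[OF s(2)] f f' by auto
  then obtain \<theta> where \<theta>: "rotate_frame first_vec \<theta> (pr m) = pr s'"
    using frame_rotation_exists unfolding f f' by blast
  obtain s1 where s1: "spin_move FrS pr (rotate_frame first_vec) \<theta> m s1"
    using spin_rotate_exists[OF mF] by blast
  obtain s2 where s2: "spin_move FrS pr (rotate_frame first_vec) (\<theta> + 2 * pi) m s2"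
    using spin_rotate_exists[OF mF] by blast
  have "rotate_frame first_vec (\<theta> + 2 * pi) (pr m) = rotate_frame first_vec \<theta> (pr m)"
    unfolding f rotate_frame_in_frames(1)[OF fr(1)] by simp
  then have fibre: "s1 \<in> {t \<in> FrS. pr t = pr s'}" "s2 \<in> {t \<in> FrS. pr t = pr s'}" "s' \<in> {t \<in> FrS. pr t = pr s'}"
    using spin_move_in[OF s1] spin_move_in[OF s2] \<theta> s by auto
  have "exp (\<i> * of_real (\<theta> + 2 * pi) / 2) = - exp (\<i> * of_real \<theta> / 2)"
    by (simp add: distrib_left add_divide_distrib exp_add)
  then have "\<kappa> s2 = - \<kappa> s1"
    unfolding spinor_rotate_first[OF s1] spinor_rotate_first[OF s2] by (simp add: spinor_scale_def)
  moreover have "\<kappa> s1 \<noteq> 0" using spinor_nonzero fibre by blast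
  moreover have "k \<noteq> - k" if "k \<noteq> 0" for k :: spinor
    using that by (auto simp: prod_eq_iff eq_neg_iff_add_eq_0 simp flip: mult_2)
  ultimately have "s1 \<noteq> s2" by metis
  moreover have "card {t \<in> FrS. pr t = pr s'} = 2"
    using spin_bundle pr_in_frames[OF s(2)] by (simp add: spin_frame_bundle_def)
  ultimately have "s' = s1 \<or> s' = s2"
    using fibre unfolding card_2_iff by (metis insertE singletonD)
  then show thesis using that[OF m] s1 s2 by blast
qed


section \<open>Lambda lengths as determinants of spinors\<close>

text \<open>The flag of the outward frame is constant along a horosphere and the horosphere is path connected, so
  the spinor is constant by unique lifting. A spin-decorated horosphere is thus a single spinor.\<close>

lemma outward_spinor_constant:
  assumes h: "horosphere z H" and w: "spin_decoration FrS pr z H Win Wout" and xy: "x \<in> H" "y \<in> H"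
  shows "\<kappa> (Wout x) = \<kappa> (Wout y)"
proof -
  obtain n where z: "z \<in> ideal_boundary" "n \<in> z" and n: "mink n n = 0" "n $ 1 > 0"
    and H: "H = {x \<in> hyp3. mink x n = - 1}"
    by (rule horosphereD[OF h])
  obtain v where v: "decoration z H v" and lift: "continuous_lift FrS pr H (outward_frame z v) Wout"
    using w unfolding spin_decoration_def by blast
  have W: "Wout u \<in> FrS" "pr (Wout u) = outward_frame z v u" if "u \<in> H" for u
    using lift that by (auto simp: continuous_lift_def)
  have fl: "flag (pr (Wout u)) = self_dual n (v x)" if u: "u \<in> H" for u
  proof -
    have "normal_out z u = n - u" using u by (intro normal_out_eq[OF z]) (auto simp: H)
    then show ?thesis
      using decoration_flag_constant[OF v z H xy(1) u] W(2)[OF u] by (simp add: outward_frame_def flag_def)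
  qed
  obtain g where g: "path g" "path_image g \<subseteq> H" "pathstart g = x" "pathfinish g = y"
    using horosphere_path[OF n H xy] by blast
  have gH: "g r \<in> H" if "r \<in> {0..1}" for r using g(2) that by (auto simp: path_image_def)
  have "\<kappa> ((Wout \<circ> g) 1) = \<kappa> (Wout x)"
  proof (rule spinor_along_path[where k = "\<lambda>_. \<kappa> (Wout x)"])
    show "path (Wout \<circ> g)"
    proof (rule path_continuous_image[OF g(1)])
      have "continuous_on H Wout" using lift by (simp add: continuous_lift_def)
      then show "continuous_on (path_image g) Wout" using g(2) by (rule continuous_on_subset)
    qed
    show "path_image (Wout \<circ> g) \<subseteq> FrS"
      using W(1) g(2) by (auto simp: path_image_compose)
    show "\<kappa> (Wout x) = \<kappa> ((Wout \<circ> g) 0)" using g(3) by (simp add: pathstart_def)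
    show "spinor_square (\<kappa> (Wout x)) = flag (pr ((Wout \<circ> g) r))" if "r \<in> {0..1}" for r
      using spinor_square_eq_flag[OF W(1)[OF xy(1)]] fl[OF xy(1)] fl[OF gH[OF that]] by simp
  qed simp
  then show ?thesis using g(4) by (simp add: pathfinish_def)
qed

text \<open>The definition of a complex lambda length as a unique value requires that the geodesic, the two points
  and the complex distance exist. With \<open>n\<close> and \<open>l\<close> the null vectors of the horospheres and
  \<open>mink n l = - k\<close>, the geodesic is \<open>(exp (- s) / 2) n + (exp s / k) l\<close>; it meets the first horosphere at
  \<open>s = 0\<close> and the second one at \<open>s = ln (k / 2)\<close>.\<close>

lemma complex_distance_exists:
  assumes h: "horosphere z\<^sub>1 H\<^sub>1" "horosphere z\<^sub>2 H\<^sub>2" and ne: "z\<^sub>1 \<noteq> z\<^sub>2"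
    and w: "spin_decoration FrS pr z\<^sub>1 H\<^sub>1 Win\<^sub>1 Wout\<^sub>1" "spin_decoration FrS pr z\<^sub>2 H\<^sub>2 Win\<^sub>2 Wout\<^sub>2"
  obtains \<gamma> p\<^sub>1 p\<^sub>2 d where "geodesic_from_to z\<^sub>1 z\<^sub>2 \<gamma>" "p\<^sub>1 \<in> range \<gamma> \<inter> H\<^sub>1" "p\<^sub>2 \<in> range \<gamma> \<inter> H\<^sub>2"
    "complex_distance FrS pr \<gamma> (Win\<^sub>1 p\<^sub>1) (Wout\<^sub>2 p\<^sub>2) d"
proof -
  obtain n where z1: "z\<^sub>1 \<in> ideal_boundary" "n \<in> z\<^sub>1" and n: "mink n n = 0" "n $ 1 > 0"
    and H1: "H\<^sub>1 = {x \<in> hyp3. mink x n = - 1}"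
    by (rule horosphereD[OF h(1)])
  obtain l where z2: "z\<^sub>2 \<in> ideal_boundary" "l \<in> z\<^sub>2" and l: "mink l l = 0" "l $ 1 > 0"
    and H2: "H\<^sub>2 = {x \<in> hyp3. mink x l = - 1}"
    by (rule horosphereD[OF h(2)])
  have "mink n l < 0"
  proof (rule ccontr)
    assume "\<not> mink n l < 0"
    then have "l = (l $ 1 / n $ 1) *\<^sub>R n" using n l by (intro null_orthogonal_parallel) auto
    then have "l \<in> z\<^sub>1" using ideal_boundary_scale[OF z1, of "l $ 1 / n $ 1"] n l by simp
    then show False using ideal_boundary_eqI z1 z2 ne by blast
  qed
  define k where "k = - mink n l"
  have k: "k > 0" "mink n l = - k" "mink l n = - k"
    using \<open>mink n l < 0\<close> mink_commute[of l n] by (simp_all add: k_def)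
  define p u \<rho> where "p = (1 / 2) *\<^sub>R n + (1 / k) *\<^sub>R l" and "u = (1 / k) *\<^sub>R l - (1 / 2) *\<^sub>R n" and "\<rho> = ln (k / 2)"
  define \<gamma> where "\<gamma> = geodesic p u"
  have \<gamma>: "\<gamma> s = (exp (- s) / 2) *\<^sub>R n + (exp s / k) *\<^sub>R l" for s
    using k(1) by (simp add: \<gamma>_def geodesic_def p_def u_def cosh_def sinh_def vec_eq_iff field_simps)
  define q where "q = \<gamma> \<rho>"
  have q: "q = (1 / k) *\<^sub>R n + (1 / 2) *\<^sub>R l"
    using k by (simp add: q_def \<gamma> \<rho>_def exp_minus)
  have pH: "p \<in> H\<^sub>1"
    unfolding H1 using k n l by (auto simp: p_def intro!: hyp3I_horosphere[OF n])
  have qH: "q \<in> H\<^sub>2"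
    unfolding H2 using k n l by (auto simp: q intro!: hyp3I_horosphere[OF l])
  have \<gamma>0: "\<gamma> 0 = p" by (simp add: \<gamma>_def geodesic_def)
  have "geodesic_from_to z\<^sub>1 z\<^sub>2 \<gamma>"
    unfolding geodesic_from_to_def
  proof (intro conjI)
    show "\<exists>x\<in>hyp3. \<exists>u. unit_tangent x u \<and> \<gamma> = geodesic x u"
    proof (intro bexI exI conjI)
      show "unit_tangent p u" using k n l by (simp add: unit_tangent_def p_def u_def)
      show "p \<in> hyp3" using pH by (simp add: H1)
    qed (rule \<gamma>_def)
    have "p + u = (2 / k) *\<^sub>R l" by (simp add: p_def u_def vec_eq_iff)
    then show "tends_to_ideal \<gamma> z\<^sub>2 at_top"
      using geodesic_limit[of p u] ideal_boundary_scale[OF z2, of "1 / l $ 1"] k l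
      unfolding tends_to_ideal_def \<gamma>_def
      by (intro bexI[of _ "(1 / l $ 1) *\<^sub>R l"]) auto
    have "p + - u = n" by (simp add: p_def u_def vec_eq_iff)
    moreover have "geodesic p (- u) s = \<gamma> (- s)" for s by (simp add: \<gamma>_def geodesic_def)
    ultimately show "tends_to_ideal \<gamma> z\<^sub>1 at_bot"
      using geodesic_limit[of p "- u"] ideal_boundary_scale[OF z1, of "1 / n $ 1"] n
      unfolding tends_to_ideal_def filterlim_at_bot_mirror
      by (intro bexI[of _ "(1 / n $ 1) *\<^sub>R n"]) auto
  qed
  moreover have "p \<in> range \<gamma> \<inter> H\<^sub>1" "q \<in> range \<gamma> \<inter> H\<^sub>2"
    using pH qH \<gamma>0 q_def by (auto intro: range_eqI[of _ _ 0])
  moreover obtain d where "complex_distance FrS pr \<gamma> (Win\<^sub>1 p) (Wout\<^sub>2 q) d"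
  proof -
    obtain v\<^sub>1 where "continuous_lift FrS pr H\<^sub>1 (inward_frame z\<^sub>1 v\<^sub>1) Win\<^sub>1"
      using w(1) unfolding spin_decoration_def by blast
    then have s: "Win\<^sub>1 p \<in> FrS" "pr (Win\<^sub>1 p) = inward_frame z\<^sub>1 v\<^sub>1 p"
      using pH by (auto simp: continuous_lift_def)
    obtain v\<^sub>2 where "continuous_lift FrS pr H\<^sub>2 (outward_frame z\<^sub>2 v\<^sub>2) Wout\<^sub>2"
      using w(2) unfolding spin_decoration_def by blast
    then have s': "Wout\<^sub>2 q \<in> FrS" "pr (Wout\<^sub>2 q) = outward_frame z\<^sub>2 v\<^sub>2 q"
      using qH by (auto simp: continuous_lift_def)
    have Np: "normal_in z\<^sub>1 p = u"
      using normal_out_eq[OF z1, of p] pH by (simp add: normal_in_def H1) (simp add: p_def u_def vec_eq_iff)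
    have Nq: "normal_out z\<^sub>2 q = l - q"
      using normal_out_eq[OF z2, of q] qH by (simp add: H2)
    have deriv: "vector_derivative \<gamma> (at t) = sinh t *\<^sub>R p + cosh t *\<^sub>R u" for t
      unfolding \<gamma>_def geodesic_def
      by (rule vector_derivative_at) (auto intro!: derivative_eq_intros)
    have vel: "sinh \<rho> *\<^sub>R p + cosh \<rho> *\<^sub>R u = l - q"
    proof -
      have "sinh \<rho> *\<^sub>R p + cosh \<rho> *\<^sub>R u = (exp \<rho> / k) *\<^sub>R l - (exp (- \<rho>) / 2) *\<^sub>R n"
        using k(1) by (simp add: p_def u_def cosh_def sinh_def vec_eq_iff field_simps)
      also have "\<dots> = l - q"
        using k by (simp add: q \<rho>_def exp_minus vec_eq_iff field_simps)
      finally show ?thesis .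
    qed
    have "adapted FrS pr \<gamma> (Win\<^sub>1 p)"
      unfolding adapted_def using s Np \<gamma>0 by (auto simp: inward_frame_def deriv intro!: exI[of _ 0])
    moreover have "adapted FrS pr \<gamma> (Wout\<^sub>2 q)"
      unfolding adapted_def using s' Nq vel q_def by (auto simp: outward_frame_def deriv intro!: exI[of _ \<rho>])
    moreover obtain m \<theta> where "spin_move FrS pr translate_frame \<rho> (Win\<^sub>1 p) m"
      "spin_move FrS pr (rotate_frame first_vec) \<theta> m (Wout\<^sub>2 q)"
    proof (rule spin_frames_join[OF s(1) s'(1)])
      show "fst (pr (Wout\<^sub>2 q)) = fst (translate_frame \<rho> (pr (Win\<^sub>1 p)))"
        by (simp add: s s' inward_frame_def outward_frame_def Np) (simp add: q_def \<gamma>_def)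
      show "first_vec (pr (Wout\<^sub>2 q)) = first_vec (translate_frame \<rho> (pr (Win\<^sub>1 p)))"
        by (simp add: s s' inward_frame_def outward_frame_def Np Nq vel)
    qed
    ultimately have "complex_distance FrS pr \<gamma> (Win\<^sub>1 p) (Wout\<^sub>2 q) (Complex \<rho> \<theta>)"
      unfolding complex_distance_def by auto
    then show thesis by (rule that)
  qed
  ultimately show thesis by (rule that)
qed

text \<open>Both the inward frame at \<open>p\<^sub>1\<close> and the outward frame at \<open>p\<^sub>2\<close> have flags at the second centre, and
  their spinors differ by the factor \<open>exp (d / 2)\<close>. The determinant of the outward spinor of the first
  horosphere with the former is \<open>- 2 \<i>\<close>, which gives its determinant with the latter.\<close>

lemma complex_lambda_length_eq_spinor_det:
  assumes h: "horosphere z\<^sub>1 H\<^sub>1" "horosphere z\<^sub>2 H\<^sub>2" and ne: "z\<^sub>1 \<noteq> z\<^sub>2"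
    and w: "spin_decoration FrS pr z\<^sub>1 H\<^sub>1 Win\<^sub>1 Wout\<^sub>1" "spin_decoration FrS pr z\<^sub>2 H\<^sub>2 Win\<^sub>2 Wout\<^sub>2"
    and x: "x\<^sub>1 \<in> H\<^sub>1" "x\<^sub>2 \<in> H\<^sub>2"
  shows "complex_lambda_length FrS pr z\<^sub>1 H\<^sub>1 Win\<^sub>1 z\<^sub>2 H\<^sub>2 Wout\<^sub>2
    = \<i> / 2 * spinor_det (\<kappa> (Wout\<^sub>1 x\<^sub>1)) (\<kappa> (Wout\<^sub>2 x\<^sub>2))"
proof -
  have exp_d: "exp (d / 2) = \<i> / 2 * spinor_det (\<kappa> (Wout\<^sub>1 x\<^sub>1)) (\<kappa> (Wout\<^sub>2 x\<^sub>2))"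
    if p: "p\<^sub>1 \<in> range \<gamma> \<inter> H\<^sub>1" "p\<^sub>2 \<in> range \<gamma> \<inter> H\<^sub>2"
      and d: "complex_distance FrS pr \<gamma> (Win\<^sub>1 p\<^sub>1) (Wout\<^sub>2 p\<^sub>2) d" for \<gamma> p\<^sub>1 p\<^sub>2 d
  proof -
    have "spin_move FrS pr (rotate_frame second_vec) (- pi) (Win\<^sub>1 p\<^sub>1) (Wout\<^sub>1 p\<^sub>1)"
      using w(1) p(1) unfolding spin_decoration_def by blast
    then have "spinor_det (\<kappa> (Wout\<^sub>1 p\<^sub>1)) (\<kappa> (Wout\<^sub>2 p\<^sub>2)) = exp (d / 2) * (- 2 * \<i>)"
      unfolding spinor_complex_distance[OF d] spinor_det_scale by (simp add: spinor_det_rotate_second)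
    moreover have "\<kappa> (Wout\<^sub>1 p\<^sub>1) = \<kappa> (Wout\<^sub>1 x\<^sub>1)" "\<kappa> (Wout\<^sub>2 p\<^sub>2) = \<kappa> (Wout\<^sub>2 x\<^sub>2)"
      using outward_spinor_constant[OF h(1) w(1) IntD2[OF p(1)] x(1)]
        outward_spinor_constant[OF h(2) w(2) IntD2[OF p(2)] x(2)] .
    ultimately have "spinor_det (\<kappa> (Wout\<^sub>1 x\<^sub>1)) (\<kappa> (Wout\<^sub>2 x\<^sub>2)) = - 2 * \<i> * exp (d / 2)"
      by simp
    moreover have "\<i> / 2 * (- 2 * \<i> * e) = e" for e
      by simp
    ultimately show ?thesis by simp
  qed
  show ?thesis
    unfolding complex_lambda_length_def
  proof (rule the_equality)
    obtain \<gamma> p\<^sub>1 p\<^sub>2 d where wit: "geodesic_from_to z\<^sub>1 z\<^sub>2 \<gamma>" "p\<^sub>1 \<in> range \<gamma> \<inter> H\<^sub>1" "p\<^sub>2 \<in> range \<gamma> \<inter> H\<^sub>2"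
      "complex_distance FrS pr \<gamma> (Win\<^sub>1 p\<^sub>1) (Wout\<^sub>2 p\<^sub>2) d"
      by (rule complex_distance_exists[OF h ne w])
    show "\<exists>\<gamma> p\<^sub>1 p\<^sub>2 d. geodesic_from_to z\<^sub>1 z\<^sub>2 \<gamma> \<and> p\<^sub>1 \<in> range \<gamma> \<inter> H\<^sub>1 \<and> p\<^sub>2 \<in> range \<gamma> \<inter> H\<^sub>2 \<and>
        complex_distance FrS pr \<gamma> (Win\<^sub>1 p\<^sub>1) (Wout\<^sub>2 p\<^sub>2) d \<and>
        \<i> / 2 * spinor_det (\<kappa> (Wout\<^sub>1 x\<^sub>1)) (\<kappa> (Wout\<^sub>2 x\<^sub>2)) = exp (d / 2)"
      using wit exp_d[OF wit(2-4), symmetric]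
      by (intro exI[of _ \<gamma>] exI[of _ p\<^sub>1] exI[of _ p\<^sub>2] exI[of _ d]) simp
  qed (use exp_d in blast)
qed

end

lemma horosphere_nonempty:
  assumes "horosphere z H"
  obtains x where "x \<in> H"
proof -
  obtain n where "z \<in> ideal_boundary" "n \<in> z" and n: "mink n n = 0" "n $ 1 > 0" and H: "H = {x \<in> hyp3. mink x n = - 1}"
    by (rule horosphereD[OF assms])
  \<comment> \<open>the null vector \<open>l\<close> is the reflection of \<open>n\<close> in the time axis; the point sought lies on the
      geodesic that joins the two rays\<close>
  define l :: "real ^ 4" where "l = vector [n $ 1, - n $ 2, - n $ 3, - n $ 4]"
  have l: "mink l l = 0" using n by (simp add: l_def mink_def)
  have nl: "mink n l = - 2 * (n $ 1)\<^sup>2" "mink l n = - 2 * (n $ 1)\<^sup>2"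
    using n by (simp_all add: l_def mink_def power2_eq_square)
  have "(1 / 2) *\<^sub>R n + (1 / (2 * (n $ 1)\<^sup>2)) *\<^sub>R l \<in> H"
    unfolding H using n l nl by (auto intro!: hyp3I_horosphere[OF n])
  then show thesis by (rule that)
qed

theorem theorem3:
  fixes FrS :: "'s::topological_space set" and pr :: "'s \<Rightarrow> frame"
    and z H :: "nat \<Rightarrow> (real ^ 4) set" and Win Wout :: "nat \<Rightarrow> real ^ 4 \<Rightarrow> 's"
    and lam :: "nat \<Rightarrow> nat \<Rightarrow> complex"
  assumes "spin_frame_bundle FrS pr"
    and "\<And>i. i < 4 \<Longrightarrow> z i \<in> ideal_boundary"
    and "inj_on z {..<4}"
    and "\<And>i. i < 4 \<Longrightarrow> horosphere (z i) (H i)"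
    and "\<And>i. i < 4 \<Longrightarrow> spin_decoration FrS pr (z i) (H i) (Win i) (Wout i)"
    and "\<And>i j. i < 4 \<Longrightarrow> j < 4 \<Longrightarrow> i \<noteq> j \<Longrightarrow>
      lam i j = complex_lambda_length FrS pr (z i) (H i) (Win i) (z j) (H j) (Wout j)"
  shows "lam 0 1 * lam 2 3 + lam 0 3 * lam 1 2 = lam 0 2 * lam 1 3"
proof -
  obtain \<kappa> where "spin_frame_spinor FrS pr \<kappa>"
    using spin_frame_spinor_exists[OF assms(1)] .
  then interpret spin_frame_spinor FrS pr \<kappa> .
  have "\<exists>x. x \<in> H i" if "i < 4" for i
    using horosphere_nonempty[OF assms(4)[OF that]] by blast
  then obtain x where x: "\<And>i. i < 4 \<Longrightarrow> x i \<in> H i" by metis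
  define k where "k = (\<lambda>i. \<kappa> (Wout i (x i)))"
  have lam: "lam i j = \<i> / 2 * spinor_det (k i) (k j)" if "i < 4" "j < 4" "i \<noteq> j" for i j
    unfolding assms(6)[OF that] k_def
    using that assms(3)
    by (intro complex_lambda_length_eq_spinor_det[OF assms(4)[OF that(1)] assms(4)[OF that(2)] _
          assms(5)[OF that(1)] assms(5)[OF that(2)] x[OF that(1)] x[OF that(2)]]) (simp add: inj_on_eq_iff)
  have scale: "(c * p) * (c * q) + (c * r) * (c * s) = (c * t) * (c * u)"
    if "p * q + r * s = t * u" for c p q r s t u :: complex
  proof -
    have "(c * p) * (c * q) + (c * r) * (c * s) = c * c * (p * q + r * s)"
      by (simp add: algebra_simps)
    also have "\<dots> = (c * t) * (c * u)" using that by simp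
    finally show ?thesis .
  qed
  show ?thesis
    using scale[OF spinor_plucker[of "k 0" "k 1" "k 2" "k 3"], of "\<i> / 2"] by (simp add: lam del: times_divide_eq_left)
qed

end
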